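(* Consider the clustered instrumental-variable setting described in the context. Assume cluster sampling, the IV assumptions, homogeneous clusters, the cluster-size condition, and the outcome model (each as stated in full under that name in the context), and proper moment and rank conditions that ensure $\inf_N\kappa_N>0$. Let $c_N=N\operatorname{var}(\bar Z)/\sigma_Z^2$, where $\bar Z=N^{-1}\sum_{i\in\mathcal I}Z_i$. Let $$V_{\mathrm{2sls},N}=\frac{1}{(\sigma_Z^2\pi_{\mathrm c})^2}\cdot\frac1N\sum_{g=1}^G\operatorname{var}\Big\{\sum_{i\in\mathcal I_g}(Z_i-e)(A_i-\mu_A)\Big\},$$ $$V_{\mathrm{2sfe},N}=\frac{1}{(\kappa_N\sigma_Z^2\pi_{\mathrm c})^2}\cdot\frac1N\sum_{g=1}^G\operatorname{var}\Big\{\sum_{i\in\mathcal I_g}(Z_i-\bar Z_g)(A_i-\bar A_g)\Big\}.$$ Then $$V_{\mathrm{2sls},N}=\frac{\sigma_\epsilon^2+\sigma_\alpha^2\cdot c_N}{\sigma_Z^2\cdot\pi_{\mathrm c}^2},\qquad V_{\mathrm{2sfe},N}=\frac{\sigma_\epsilon^2}{\kappa_N\cdot\sigma_Z^2\cdot\pi_{\mathrm c}^2},\qquad \frac{V_{\mathrm{2sls},N}}{V_{\mathrm{2sfe},N}}=\kappa_N\Big(1+\frac{\sigma_\alpha^2}{\sigma_\epsilon^2}\cdot c_N\Big),$$ where (i) $V_{\mathrm{2sls},N}>V_{\mathrm{2sfe},N}$ if and only if $$\frac{\sigma_\alpha^2}{\sigma_\epsilon^2}>\frac{1-\kappa_N}{\kappa_N}\cdot\frac1{c_N};$$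 (ii) $V_{\mathrm{2sls},N}=V_{\mathrm{2sfe},N}$ if $\operatorname{var}(\bar Z_g)=0$ for all $g$.
   Context: Setting. $N$ units are partitioned into $G$ clusters; cluster $g$ has unit set $\mathcal I_g=\{gj:j=1,\dots,n_g\}$, $n_g\ge1$, $\sum_g n_g=N$; $\mathcal I=\bigcup_g\mathcal I_g$; $c(i)$ is the cluster of unit $i$. $G$ and $(n_g)$ are nonrandom and may depend on $N$. Each unit has a binary instrument $Z_i\in\{0,1\}$, potential treatments $D_i(z)\in\{0,1\}$ ($z=0,1$), potential outcomes $Y_i(z,d)\in\mathbb R$ ($z,d=0,1$), and covariates $X_i\in\mathbb R^p$. Observed: $D_i=D_i(Z_i)$, $Y_i=Y_i(Z_i,D_i)$. Let $\mathcal Q_i=\{Y_i(z,d),D_i(z),Z_i,X_i: z,d=0,1\}$. Compliance type $U_i$: $\mathrm a$ (always-taker) if $D_i(1)=D_i(0)=1$; $\mathrm c$ (complier) if $D_i(1)=1,D_i(0)=0$; $\mathrm n$ (never-taker) if $D_i(1)=D_i(0)=0$; $\mathrm d$ (defier) if $D_i(1)=0,D_i(0)=1$. Cluster sampling: the collections $\{\mathcal Q_i:i\in\mathcal I_g\}$, $g=1,\dots,G$, are independent (arbitrary dependence within clusters is allowed). IV assumptions, for all $i$: (i) $Y_i(0,d)=Y_i(1,d)=:Y_i(d)$ for $d=0,1$; (ii) for each $g$, $\{Z_i:i\in\mathcal I_g\}$ is independent of $\{Y_i(z,d),D_i(z),X_i:z,d=0,1;\,i\in\mathcal I_g\}$;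 (iii) $0<\mathbb P(Z_i=1)<1$; (iv) $\mathbb E\{D_i(1)-D_i(0)\}\ne0$; (v) $D_i(1)\ge D_i(0)$. Homogeneous clusters: $\{\mathcal Q_i:i\in\mathcal I\}$ are identically distributed. Cluster-size condition: as $N\to\infty$, $\max_{g}n_g^2/N\to0$ and $\limsup_{N\to\infty}N^{-1}\sum_{g=1}^Gn_g^2<\infty$. Outcome model: (i) $\tau_i=\tau_{\mathrm c}$ for compliers; (ii) $Y_i=D_i\tau_{\mathrm c}+\alpha_{c(i)}+\epsilon_i$ for all $i$, where $\alpha_g\in\mathbb R$ are unobserved cluster-specific effects and $\epsilon_i\in\mathbb R$ unobserved unit-level errors with $\mathbb E(\alpha_g)=\mu_\alpha$, $\operatorname{var}(\alpha_g)=\sigma_\alpha^2$ for unknown constants $\mu_\alpha,\sigma_\alpha^2$; the vectors $\epsilon_{[g]}=(\epsilon_{g1},\dots,\epsilon_{g,n_g})^\top$ are independent across $g$; $\mathbb E(\epsilon_{[g]}\mid\alpha_g)=0$ and $\operatorname{cov}(\epsilon_{[g]}\mid\alpha_g)=\sigma_\epsilon^2I_{n_g}$ for an unknown constant $\sigma_\epsilon^2>0$. Notation. $\tau_i=Y_i(1)-Y_i(0)$; $\tau_{\mathrm c}=\mathbb E(\tau_i\mid U_i=\mathrm c)$; $\pi_{\mathrm c}=\mathbb P(U_i=\mathrm c)$; $e=\mathbb P(Z_i=1)$; $\sigma_Z^2=\operatorname{var}(Z_i)$; $A_i=Y_i-D_i\tau_{\mathrm c}$, $\mu_A=\mathbb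 E(A_i)$; $\bar Z_g=n_g^{-1}\sum_{i\in\mathcal I_g}Z_i$, $\bar A_g=n_g^{-1}\sum_{i\in\mathcal I_g}A_i$; $S_{Z,\mathrm{in}}=N^{-1}\sum_{i\in\mathcal I}(Z_i-\bar Z_{c(i)})^2$; $\kappa_N=\mathbb E(S_{Z,\mathrm{in}})/\sigma_Z^2$. Role of the objects. $V_{\mathrm{2sls},N}$ and $V_{\mathrm{2sfe},N}$ are the asymptotic variances of the canonical 2SLS estimator (2SLS of $Y_i$ on $(1,D_i)$ instrumented by $(1,Z_i)$) and of the 2SLS estimator with cluster fixed effects (2SLS of $Y_i$ on $D_i$ and cluster indicators instrumented by $Z_i$ and cluster indicators). The moment and rank conditions are not spelled out in the statement itself; the formal ones the source gives for the central limit theorems of these two estimators are $\mathbb E(Y_i^4)<\infty$, $\inf_N\kappa_N>0$, and $\inf_N\lambda_{\min}(\Omega_N)>0$, where $\lambda_{\min}$ is the smallest eigenvalue and $\Omega_N=N^{-1}\operatorname{cov}\big\{\sum_{i\in\mathcal I}\big(A_i-\mu_A,\;Z_i(A_i-\mu_A),\;(Z_i-\bar Z_{c(i)})(A_i-\bar A_{c(i)})\big)^\top\big\}$. *)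

theory Defs
  imports "HOL-Probability.Probability"
begin

text \<open>
  One population together with its probability space. A unit is a pair (g, j) with
  cluster g < nclust and position j < csize g; thus the cluster of a unit is its first component.
  Instruments and treatments are Booleans, and the arguments of ypot are z and d in this order.
  An asymptotic regime is a sequence of such populations.
\<close>

record ('w, 'p::finite) population =
  pmeas :: "'w measure"
  nclust :: nat
  csize :: "nat \<Rightarrow> nat"
  ypot :: "nat \<times> nat \<Rightarrow> bool \<Rightarrow> bool \<Rightarrow> 'w \<Rightarrow> real"
  dpot :: "nat \<times> nat \<Rightarrow> bool \<Rightarrow> 'w \<Rightarrow> bool"
  zinst :: "nat \<times> nat \<Rightarrow> 'w \<Rightarrow> bool"
  xcov :: "nat \<times> nat \<Rightarrow> 'w \<Rightarrow> real ^ 'p"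
  alpha :: "nat \<Rightarrow> 'w \<Rightarrow> real"
  eps :: "nat \<times> nat \<Rightarrow> 'w \<Rightarrow> real"

abbreviation mean :: "('w, 'p::finite) population \<Rightarrow> ('w \<Rightarrow> real) \<Rightarrow> real" where
  "mean P f \<equiv> prob_space.expectation (pmeas P) f"

abbreviation var :: "('w, 'p::finite) population \<Rightarrow> ('w \<Rightarrow> real) \<Rightarrow> real" where
  "var P f \<equiv> prob_space.variance (pmeas P) f"

definition cluster_units :: "('w, 'p::finite) population \<Rightarrow> nat \<Rightarrow> (nat \<times> nat) set" where
  "cluster_units P g = {g} \<times> {..<csize P g}"

definition all_units :: "('w, 'p::finite) population \<Rightarrow> (nat \<times> nat) set" where
  "all_units P = (\<Union>g<nclust P. cluster_units P g)"

definition popsize :: "('w, 'p::finite) population \<Rightarrow> nat" where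
  "popsize P = (\<Sum>g<nclust P. csize P g)"

definition d_obs :: "('w, 'p::finite) population \<Rightarrow> nat \<times> nat \<Rightarrow> 'w \<Rightarrow> bool" where
  "d_obs P i \<omega> = dpot P i (zinst P i \<omega>) \<omega>"

definition y_obs :: "('w, 'p::finite) population \<Rightarrow> nat \<times> nat \<Rightarrow> 'w \<Rightarrow> real" where
  "y_obs P i \<omega> = ypot P i (zinst P i \<omega>) (d_obs P i \<omega>) \<omega>"

text \<open>
  The data of a unit other than its instrument, as one random element: the potential outcomes
  in the order (z, d) = (0, 0), (0, 1), (1, 0), (1, 1), the potential treatments for z = 0, 1, and the
  covariates. Q_unit adds the instrument.
\<close>

type_synonym 'p potentials =
  "(real \<times> real \<times> real \<times> real) \<times> (bool \<times> bool) \<times> (real ^ 'p)"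

definition potentials_space :: "('p::finite) potentials measure" where
  "potentials_space = borel \<Otimes>\<^sub>M count_space UNIV \<Otimes>\<^sub>M borel"

definition potentials ::
    "('w, 'p::finite) population \<Rightarrow> nat \<times> nat \<Rightarrow> 'w \<Rightarrow> 'p potentials" where
  "potentials P i \<omega> =
    ((ypot P i False False \<omega>, ypot P i False True \<omega>, ypot P i True False \<omega>, ypot P i True True \<omega>),
     (dpot P i False \<omega>, dpot P i True \<omega>), xcov P i \<omega>)"

definition Q_space :: "(bool \<times> ('p::finite) potentials) measure" where
  "Q_space = count_space UNIV \<Otimes>\<^sub>M potentials_space"

definition Q_unit ::
    "('w, 'p::finite) population \<Rightarrow> nat \<times> nat \<Rightarrow> 'w \<Rightarrow> bool \<times> 'p potentials" where
  "Q_unit P i \<omega> = (zinst P i \<omega>, potentials P i \<omega>)"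

definition clustered_population :: "('w, 'p::finite) population \<Rightarrow> bool" where
  "clustered_population P \<longleftrightarrow>
     prob_space (pmeas P) \<and> 1 \<le> nclust P \<and> (\<forall>g<nclust P. 1 \<le> csize P g) \<and>
     (\<forall>i\<in>all_units P. Q_unit P i \<in> measurable (pmeas P) Q_space)"

definition cluster_sampling :: "('w, 'p::finite) population \<Rightarrow> bool" where
  "cluster_sampling P \<longleftrightarrow>
     prob_space.indep_vars (pmeas P) (\<lambda>g. PiM (cluster_units P g) (\<lambda>_. Q_space))
       (\<lambda>g \<omega>. \<lambda>i\<in>cluster_units P g. Q_unit P i \<omega>) {..<nclust P}"

definition homogeneous_clusters :: "('w, 'p::finite) population \<Rightarrow> bool" where
  "homogeneous_clusters P \<longleftrightarrow>
     (\<forall>i\<in>all_units P. \<forall>j\<in>all_units P.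
        distr (pmeas P) Q_space (Q_unit P i) = distr (pmeas P) Q_space (Q_unit P j))"

text \<open>
  Independence of two random elements with values in possibly different types; the
  library constant indep_var requires both values to have the same type.
\<close>

definition indep_rv ::
    "'w measure \<Rightarrow> 'a measure \<Rightarrow> ('w \<Rightarrow> 'a) \<Rightarrow> 'b measure \<Rightarrow> ('w \<Rightarrow> 'b) \<Rightarrow> bool" where
  "indep_rv M S X T Y \<longleftrightarrow>
     X \<in> measurable M S \<and> Y \<in> measurable M T \<and>
     prob_space.indep_set M (sets (vimage_algebra (space M) X S))
                            (sets (vimage_algebra (space M) Y T))"

definition iv_assumptions :: "('w, 'p::finite) population \<Rightarrow> bool" where
  "iv_assumptions P \<longleftrightarrow>
     (\<forall>i\<in>all_units P. \<forall>d. AE \<omega> in pmeas P. ypot P i False d \<omega> = ypot P i True d \<omega>) \<and>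
     (\<forall>g<nclust P.
        indep_rv (pmeas P)
          (PiM (cluster_units P g) (\<lambda>_. count_space UNIV))
          (\<lambda>\<omega>. \<lambda>i\<in>cluster_units P g. zinst P i \<omega>)
          (PiM (cluster_units P g) (\<lambda>_. potentials_space))
          (\<lambda>\<omega>. \<lambda>i\<in>cluster_units P g. potentials P i \<omega>)) \<and>
     (\<forall>i\<in>all_units P.
        0 < measure (pmeas P) {\<omega> \<in> space (pmeas P). zinst P i \<omega>} \<and>
        measure (pmeas P) {\<omega> \<in> space (pmeas P). zinst P i \<omega>} < 1) \<and>
     (\<forall>i\<in>all_units P. mean P (\<lambda>\<omega>. of_bool (dpot P i True \<omega>) - of_bool (dpot P i False \<omega>)) \<noteq> 0) \<and>
     (\<forall>i\<in>all_units P. AE \<omega> in pmeas P. dpot P i False \<omega> \<le> dpot P i True \<omega>)"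

datatype compliance = Always_taker | Complier | Never_taker | Defier

definition ctype :: "('w, 'p::finite) population \<Rightarrow> nat \<times> nat \<Rightarrow> 'w \<Rightarrow> compliance" where
  "ctype P i \<omega> =
     (if dpot P i True \<omega> then (if dpot P i False \<omega> then Always_taker else Complier)
      else (if dpot P i False \<omega> then Defier else Never_taker))"

text \<open>
  The outcome Y(d) is read off at z = 0; by the exclusion restriction z = 1 gives the same.
\<close>

definition unit_effect :: "('w, 'p::finite) population \<Rightarrow> nat \<times> nat \<Rightarrow> 'w \<Rightarrow> real" where
  "unit_effect P i \<omega> = ypot P i False True \<omega> - ypot P i False False \<omega>"

text \<open>
  The population parameters without a unit index are evaluated at the unit (0, 0), which exists in
  every clustered population. Under homogeneous clusters every other unit gives the same value.
\<close>

definition complier_event :: "('w, 'p::finite) population \<Rightarrow> 'w set" where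
  "complier_event P = {\<omega> \<in> space (pmeas P). ctype P (0, 0) \<omega> = Complier}"

definition pi_c :: "('w, 'p::finite) population \<Rightarrow> real" where
  "pi_c P = measure (pmeas P) (complier_event P)"

definition tau_c :: "('w, 'p::finite) population \<Rightarrow> real" where
  "tau_c P = (LINT \<omega>:complier_event P|pmeas P. unit_effect P (0, 0) \<omega>) / pi_c P"

definition z_prob :: "('w, 'p::finite) population \<Rightarrow> real" where
  "z_prob P = measure (pmeas P) {\<omega> \<in> space (pmeas P). zinst P (0, 0) \<omega>}"

definition sigma2_Z :: "('w, 'p::finite) population \<Rightarrow> real" where
  "sigma2_Z P = var P (\<lambda>\<omega>. of_bool (zinst P (0, 0) \<omega>))"

definition A_unit :: "('w, 'p::finite) population \<Rightarrow> nat \<times> nat \<Rightarrow> 'w \<Rightarrow> real" where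
  "A_unit P i \<omega> = y_obs P i \<omega> - of_bool (d_obs P i \<omega>) * tau_c P"

definition mu_A :: "('w, 'p::finite) population \<Rightarrow> real" where
  "mu_A P = mean P (A_unit P (0, 0))"

definition zbar_cluster :: "('w, 'p::finite) population \<Rightarrow> nat \<Rightarrow> 'w \<Rightarrow> real" where
  "zbar_cluster P g \<omega> = (\<Sum>i\<in>cluster_units P g. of_bool (zinst P i \<omega>)) / real (csize P g)"

definition Abar_cluster :: "('w, 'p::finite) population \<Rightarrow> nat \<Rightarrow> 'w \<Rightarrow> real" where
  "Abar_cluster P g \<omega> = (\<Sum>i\<in>cluster_units P g. A_unit P i \<omega>) / real (csize P g)"

definition zbar :: "('w, 'p::finite) population \<Rightarrow> 'w \<Rightarrow> real" where
  "zbar P \<omega> = (\<Sum>i\<in>all_units P. of_bool (zinst P i \<omega>)) / real (popsize P)"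

definition S_Z_in :: "('w, 'p::finite) population \<Rightarrow> 'w \<Rightarrow> real" where
  "S_Z_in P \<omega> =
     (\<Sum>i\<in>all_units P. (of_bool (zinst P i \<omega>) - zbar_cluster P (fst i) \<omega>)\<^sup>2) / real (popsize P)"

definition kappa :: "('w, 'p::finite) population \<Rightarrow> real" where
  "kappa P = mean P (S_Z_in P) / sigma2_Z P"

definition c_N :: "('w, 'p::finite) population \<Rightarrow> real" where
  "c_N P = real (popsize P) * var P (zbar P) / sigma2_Z P"

definition V_2sls :: "('w, 'p::finite) population \<Rightarrow> real" where
  "V_2sls P =
     1 / (sigma2_Z P * pi_c P)\<^sup>2 *
     (1 / real (popsize P) *
       (\<Sum>g<nclust P. var P (\<lambda>\<omega>. \<Sum>i\<in>cluster_units P g.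
          (of_bool (zinst P i \<omega>) - z_prob P) * (A_unit P i \<omega> - mu_A P))))"

definition V_2sfe :: "('w, 'p::finite) population \<Rightarrow> real" where
  "V_2sfe P =
     1 / (kappa P * sigma2_Z P * pi_c P)\<^sup>2 *
     (1 / real (popsize P) *
       (\<Sum>g<nclust P. var P (\<lambda>\<omega>. \<Sum>i\<in>cluster_units P g.
          (of_bool (zinst P i \<omega>) - zbar_cluster P g \<omega>) * (A_unit P i \<omega> - Abar_cluster P g \<omega>))))"

definition sigma_alg_alpha :: "('w, 'p::finite) population \<Rightarrow> nat \<Rightarrow> 'w measure" where
  "sigma_alg_alpha P g = vimage_algebra (space (pmeas P)) (alpha P g) borel"

definition cond_cov ::
    "'w measure \<Rightarrow> 'w measure \<Rightarrow> ('w \<Rightarrow> real) \<Rightarrow> ('w \<Rightarrow> real) \<Rightarrow> 'w \<Rightarrow> real" where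
  "cond_cov M F X Y =
     real_cond_exp M F (\<lambda>\<omega>. (X \<omega> - real_cond_exp M F X \<omega>) * (Y \<omega> - real_cond_exp M F Y \<omega>))"

text \<open>
  The square-integrability conditions express that the moments in the model exist; without them
  the integrals below would default to 0.
\<close>

definition outcome_model ::
    "('w, 'p::finite) population \<Rightarrow> real \<Rightarrow> real \<Rightarrow> real \<Rightarrow> bool" where
  "outcome_model P mu_alpha sigma_alpha sigma_eps \<longleftrightarrow>
     (\<forall>i\<in>all_units P. AE \<omega> in pmeas P. ctype P i \<omega> = Complier \<longrightarrow> unit_effect P i \<omega> = tau_c P) \<and>
     (\<forall>i\<in>all_units P. AE \<omega> in pmeas P.
        y_obs P i \<omega> = of_bool (d_obs P i \<omega>) * tau_c P + alpha P (fst i) \<omega> + eps P i \<omega>) \<and>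
     (\<forall>g<nclust P.
        alpha P g \<in> borel_measurable (pmeas P) \<and>
        integrable (pmeas P) (\<lambda>\<omega>. (alpha P g \<omega>)\<^sup>2) \<and>
        mean P (alpha P g) = mu_alpha \<and> var P (alpha P g) = sigma_alpha\<^sup>2) \<and>
     (\<forall>i\<in>all_units P.
        eps P i \<in> borel_measurable (pmeas P) \<and> integrable (pmeas P) (\<lambda>\<omega>. (eps P i \<omega>)\<^sup>2)) \<and>
     prob_space.indep_vars (pmeas P) (\<lambda>g. PiM (cluster_units P g) (\<lambda>_. borel))
       (\<lambda>g \<omega>. \<lambda>i\<in>cluster_units P g. eps P i \<omega>) {..<nclust P} \<and>
     (\<forall>g<nclust P. \<forall>i\<in>cluster_units P g.
        AE \<omega> in pmeas P. real_cond_exp (pmeas P) (sigma_alg_alpha P g) (eps P i) \<omega> = 0) \<and>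
     (\<forall>g<nclust P. \<forall>i\<in>cluster_units P g. \<forall>j\<in>cluster_units P g.
        AE \<omega> in pmeas P. cond_cov (pmeas P) (sigma_alg_alpha P g) (eps P i) (eps P j) \<omega>
                         = (if i = j then sigma_eps\<^sup>2 else 0)) \<and>
     0 < sigma_eps\<^sup>2"

definition cluster_size_condition :: "(nat \<Rightarrow> ('w, 'p::finite) population) \<Rightarrow> bool" where
  "cluster_size_condition P \<longleftrightarrow>
     (\<lambda>k. Max ((\<lambda>g. (real (csize (P k) g))\<^sup>2) ` {..<nclust (P k)}) / real (popsize (P k)))
       \<longlonglongrightarrow> 0 \<and>
     limsup (\<lambda>k. ereal ((\<Sum>g<nclust (P k). (real (csize (P k) g))\<^sup>2) / real (popsize (P k)))) < \<infinity>"

end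

theory Submission
  imports Defs
begin

text \<open>
  By monotonicity and exclusion, A is almost surely a function of the potential outcomes and
  treatments alone, hence independent of the instruments of its cluster, while by the outcome model
  it has the exchangeable covariance sigma_alpha^2 + sigma_eps^2 [i = j] within a cluster. For
  weights W that depend on the instruments only, the variance of the sum of W_i (A_i - mu_A) is then
  sigma_alpha^2 E (sum W_i)^2 + sigma_eps^2 sum E W_i^2. The weights Z_i - e give the variance for
  2SLS, and the deviations from the cluster mean, which sum to zero, give the one with fixed effects.
\<close>

text \<open>The instruments of one cluster may be arbitrarily dependent, so E (sum W_i)^2 cannot be
  computed from sigma_Z^2. For W_i = Z_i - e it is n_g^2 var(zbar_g), and independence between
  clusters adds these terms up to N^2 var(zbar) = N c_N sigma_Z^2; this is where c_N comes from. For
  W_i = Z_i - zbar_g the sum of E W_i^2 over all units is N kappa_N sigma_Z^2 by the definition of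
  kappa_N, so that one of the two factors kappa_N in the denominator of \<open>V_2sfe\<close>
  cancels. The net outcome A has two almost sure representations with different uses. The one in the
  potentials gives independence of the instruments, about which alpha_g + eps_i says nothing; the
  one as alpha_g + eps_i gives the moments. Both are exact in each population, so no limit is
  taken.\<close>

section \<open>Independence and variances of sums\<close>

lemma integrable_mult_of_squares:
  fixes f g :: "'a \<Rightarrow> real"
  assumes [measurable]: "f \<in> borel_measurable M" "g \<in> borel_measurable M"
    and "integrable M (\<lambda>x. (f x)\<^sup>2)" "integrable M (\<lambda>x. (g x)\<^sup>2)"
  shows "integrable M (\<lambda>x. f x * g x)"
proof (rule Bochner_Integration.integrable_bound)
  show "integrable M (\<lambda>x. (f x)\<^sup>2 + (g x)\<^sup>2)"
    using assms by simp
  have "\<bar>a * b\<bar> \<le> a\<^sup>2 + b\<^sup>2" for a b :: real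
  proof -
    have "2 * (\<bar>a\<bar> * \<bar>b\<bar>) \<le> a\<^sup>2 + b\<^sup>2"
      using sum_squares_bound[of "\<bar>a\<bar>" "\<bar>b\<bar>"] by (simp add: mult.assoc)
    moreover have "0 \<le> \<bar>a\<bar> * \<bar>b\<bar>"
      by simp
    ultimately show ?thesis
      unfolding abs_mult by linarith
  qed
  then show "AE x in M. norm (f x * g x) \<le> norm ((f x)\<^sup>2 + (g x)\<^sup>2)"
    by simp
qed simp

context prob_space
begin

text \<open>Independence passes to smaller sigma-algebras, and f(X) generates a part of the one
  pulled back along X. This leads from \<open>indep_rv\<close>, whose two value types may differ, to
  \<open>indep_var\<close>, for which expectations of products factor.\<close>

lemma indep_rv_imp_indep_var:
  assumes XY: "indep_rv M S X T Y"
    and f[measurable]: "f \<in> measurable S N" and g[measurable]: "g \<in> measurable T L"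
  shows "indep_var N (\<lambda>\<omega>. f (X \<omega>)) L (\<lambda>\<omega>. g (Y \<omega>))"
proof -
  have X[measurable]: "X \<in> measurable M S" and Y[measurable]: "Y \<in> measurable M T"
    using XY by (auto simp: indep_rv_def)
  have sub: "sigma_sets (space M) {(\<lambda>\<omega>. h (U \<omega>)) -` A \<inter> space M | A. A \<in> sets K}
      \<subseteq> sets (vimage_algebra (space M) U R)"
    if U: "U \<in> measurable M R" and h: "h \<in> measurable R K" for U R h K
  proof -
    have "U \<in> measurable (vimage_algebra (space M) U R) R"
      using U by (intro measurable_vimage_algebra1) (auto simp: measurable_def)
    then have "(\<lambda>\<omega>. h (U \<omega>)) \<in> measurable (vimage_algebra (space M) U R) K"
      using h by simp
    from measurable_sets[OF this]
    have "{(\<lambda>\<omega>. h (U \<omega>)) -` A \<inter> space M | A. A \<in> sets K} \<subseteq> sets (vimage_algebra (space M) U R)"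
      by auto
    from sets.sigma_sets_subset[OF this] show ?thesis
      by simp
  qed
  have "indep_set (sigma_sets (space M) {(\<lambda>\<omega>. f (X \<omega>)) -` A \<inter> space M | A. A \<in> sets N})
     (sigma_sets (space M) {(\<lambda>\<omega>. g (Y \<omega>)) -` A \<inter> space M | A. A \<in> sets L})"
    unfolding indep_set_def
  proof (rule indep_sets_mono_sets)
    show "indep_sets (case_bool (sets (vimage_algebra (space M) X S))
        (sets (vimage_algebra (space M) Y T))) UNIV"
      using XY by (simp add: indep_rv_def indep_set_def)
    show "case_bool (sigma_sets (space M) {(\<lambda>\<omega>. f (X \<omega>)) -` A \<inter> space M | A. A \<in> sets N})
        (sigma_sets (space M) {(\<lambda>\<omega>. g (Y \<omega>)) -` A \<inter> space M | A. A \<in> sets L}) i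
      \<subseteq> case_bool (sets (vimage_algebra (space M) X S)) (sets (vimage_algebra (space M) Y T)) i" for i
      by (cases i) (simp_all only: bool.case sub[OF X f] sub[OF Y g])
  qed
  then show ?thesis
    by (simp add: indep_var_eq)
qed

lemma indep_rv_integral_mult:
  fixes f :: "'b \<Rightarrow> real" and g :: "'c \<Rightarrow> real"
  assumes "indep_rv M S X T Y" "f \<in> borel_measurable S" "g \<in> borel_measurable T"
    and "integrable M (\<lambda>\<omega>. f (X \<omega>))" "integrable M (\<lambda>\<omega>. g (Y \<omega>))"
  shows "integrable M (\<lambda>\<omega>. f (X \<omega>) * g (Y \<omega>))"
    and "expectation (\<lambda>\<omega>. f (X \<omega>) * g (Y \<omega>))
      = expectation (\<lambda>\<omega>. f (X \<omega>)) * expectation (\<lambda>\<omega>. g (Y \<omega>))"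
proof -
  note ind = indep_rv_imp_indep_var[OF assms(1-3)]
  show "integrable M (\<lambda>\<omega>. f (X \<omega>) * g (Y \<omega>))"
    by (rule indep_var_integrable[OF ind assms(4,5)])
  show "expectation (\<lambda>\<omega>. f (X \<omega>) * g (Y \<omega>))
      = expectation (\<lambda>\<omega>. f (X \<omega>)) * expectation (\<lambda>\<omega>. g (Y \<omega>))"
    by (rule indep_var_lebesgue_integral[OF ind assms(4,5)])
qed

text \<open>In the expanded square each pair factors into E(w_i w_j) E(b_i b_j) by independence. The
  constant s weights all pairs alike, which reassembles the square of the sum of the weights, and t
  keeps the diagonal only. Bounded weights and square integrable b suffice: after grouping the
  factors in X and those in Y, each product is one of independent integrable variables.\<close>

lemma variance_sum_mult_exchangeable:
  fixes w :: "'i \<Rightarrow> 'b \<Rightarrow> real" and b :: "'i \<Rightarrow> 'c \<Rightarrow> real"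
  assumes XY: "indep_rv M S X T Y" and I: "finite I"
    and w[measurable]: "\<And>i. i \<in> I \<Longrightarrow> w i \<in> borel_measurable S"
    and bound: "\<And>i x. i \<in> I \<Longrightarrow> \<bar>w i x\<bar> \<le> c"
    and b[measurable]: "\<And>i. i \<in> I \<Longrightarrow> b i \<in> borel_measurable T"
    and sq: "\<And>i. i \<in> I \<Longrightarrow> integrable M (\<lambda>\<omega>. (b i (Y \<omega>))\<^sup>2)"
    and centred: "\<And>i. i \<in> I \<Longrightarrow> expectation (\<lambda>\<omega>. b i (Y \<omega>)) = 0"
    and cov: "\<And>i j. i \<in> I \<Longrightarrow> j \<in> I \<Longrightarrow>
      expectation (\<lambda>\<omega>. b i (Y \<omega>) * b j (Y \<omega>)) = s + (if i = j then t else 0)"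
  shows "variance (\<lambda>\<omega>. \<Sum>i\<in>I. w i (X \<omega>) * b i (Y \<omega>))
    = s * expectation (\<lambda>\<omega>. (\<Sum>i\<in>I. w i (X \<omega>))\<^sup>2)
      + t * (\<Sum>i\<in>I. expectation (\<lambda>\<omega>. (w i (X \<omega>))\<^sup>2))"
proof -
  have [measurable]: "X \<in> measurable M S" "Y \<in> measurable M T"
    using XY by (auto simp: indep_rv_def)
  have int_b: "integrable M (\<lambda>\<omega>. b i (Y \<omega>))" if "i \<in> I" for i
    using that by (intro square_integrable_imp_integrable[OF _ sq]) simp_all
  have int_bb: "integrable M (\<lambda>\<omega>. b i (Y \<omega>) * b j (Y \<omega>))" if "i \<in> I" "j \<in> I" for i j
    using that by (intro integrable_mult_of_squares sq) simp_all
  have int_w: "integrable M (\<lambda>\<omega>. w i (X \<omega>))" if "i \<in> I" for i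
    using that by (intro integrable_const_bound[where B=c]) (simp_all add: bound)
  have int_ww: "integrable M (\<lambda>\<omega>. w i (X \<omega>) * w j (X \<omega>))" if "i \<in> I" "j \<in> I" for i j
  proof (rule integrable_const_bound[where B="c * c"])
    have "\<bar>w i x * w j x\<bar> \<le> c * c" for x
      using bound[OF that(1), of x] bound[OF that(2), of x] by (simp add: abs_mult mult_mono)
    then show "AE \<omega> in M. norm (w i (X \<omega>) * w j (X \<omega>)) \<le> c * c"
      by simp
  qed (use that in simp)
  have term_int: "integrable M (\<lambda>\<omega>. w i (X \<omega>) * b i (Y \<omega>))"
    and term_zero: "expectation (\<lambda>\<omega>. w i (X \<omega>) * b i (Y \<omega>)) = 0" if "i \<in> I" for i
    using indep_rv_integral_mult[OF XY w[OF that] b[OF that] int_w[OF that] int_b[OF that]]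
      centred[OF that] by auto
  have pair_int: "integrable M (\<lambda>\<omega>. (w i (X \<omega>) * b i (Y \<omega>)) * (w j (X \<omega>) * b j (Y \<omega>)))"
    and pair: "expectation (\<lambda>\<omega>. (w i (X \<omega>) * b i (Y \<omega>)) * (w j (X \<omega>) * b j (Y \<omega>)))
      = expectation (\<lambda>\<omega>. w i (X \<omega>) * w j (X \<omega>)) * (s + (if i = j then t else 0))"
    if "i \<in> I" "j \<in> I" for i j
  proof -
    have "(\<lambda>x. w i x * w j x) \<in> borel_measurable S" "(\<lambda>y. b i y * b j y) \<in> borel_measurable T"
      using that by measurable
    from indep_rv_integral_mult[OF XY this int_ww[OF that] int_bb[OF that]]
    show "integrable M (\<lambda>\<omega>. (w i (X \<omega>) * b i (Y \<omega>)) * (w j (X \<omega>) * b j (Y \<omega>)))"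
      and "expectation (\<lambda>\<omega>. (w i (X \<omega>) * b i (Y \<omega>)) * (w j (X \<omega>) * b j (Y \<omega>)))
        = expectation (\<lambda>\<omega>. w i (X \<omega>) * w j (X \<omega>)) * (s + (if i = j then t else 0))"
      unfolding cov[OF that] by (simp_all only: mult_ac)
  qed
  have "expectation (\<lambda>\<omega>. \<Sum>i\<in>I. w i (X \<omega>) * b i (Y \<omega>)) = 0"
    by (subst Bochner_Integration.integral_sum) (auto simp: term_int term_zero)
  then have "variance (\<lambda>\<omega>. \<Sum>i\<in>I. w i (X \<omega>) * b i (Y \<omega>))
      = expectation (\<lambda>\<omega>. \<Sum>i\<in>I. \<Sum>j\<in>I. (w i (X \<omega>) * b i (Y \<omega>)) * (w j (X \<omega>) * b j (Y \<omega>)))"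
    by (simp add: power2_eq_square sum_product)
  also have "\<dots> = (\<Sum>i\<in>I. \<Sum>j\<in>I.
      expectation (\<lambda>\<omega>. w i (X \<omega>) * w j (X \<omega>)) * (s + (if i = j then t else 0)))"
    by (simp add: Bochner_Integration.integral_sum pair_int pair)
  also have "\<dots> = (\<Sum>i\<in>I. \<Sum>j\<in>I. s * expectation (\<lambda>\<omega>. w i (X \<omega>) * w j (X \<omega>))
      + (if i = j then t * expectation (\<lambda>\<omega>. w i (X \<omega>) * w j (X \<omega>)) else 0))"
    by (intro sum.cong refl) (simp add: algebra_simps)
  also have "\<dots> = s * (\<Sum>i\<in>I. \<Sum>j\<in>I. expectation (\<lambda>\<omega>. w i (X \<omega>) * w j (X \<omega>)))
      + t * (\<Sum>i\<in>I. expectation (\<lambda>\<omega>. (w i (X \<omega>))\<^sup>2))"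
    using I by (simp add: sum.distrib sum_distrib_left power2_eq_square)
  also have "(\<Sum>i\<in>I. \<Sum>j\<in>I. expectation (\<lambda>\<omega>. w i (X \<omega>) * w j (X \<omega>)))
      = expectation (\<lambda>\<omega>. (\<Sum>i\<in>I. w i (X \<omega>))\<^sup>2)"
    by (simp add: power2_eq_square sum_product Bochner_Integration.integral_sum int_ww)
  finally show ?thesis .
qed

text \<open>Bienayme's identity: independence of each pair makes the off-diagonal covariances
  vanish.\<close>

lemma variance_sum_indep:
  fixes X :: "'i \<Rightarrow> 'a \<Rightarrow> real"
  assumes I: "finite I" and ind: "indep_vars (\<lambda>_. borel) X I"
    and sq: "\<And>i. i \<in> I \<Longrightarrow> integrable M (\<lambda>\<omega>. (X i \<omega>)\<^sup>2)"
  shows "variance (\<lambda>\<omega>. \<Sum>i\<in>I. X i \<omega>) = (\<Sum>i\<in>I. variance (X i))"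
proof -
  have [measurable]: "X i \<in> borel_measurable M" if "i \<in> I" for i
    using ind that by (auto simp: indep_vars_def)
  have int: "integrable M (X i)" if "i \<in> I" for i
    using that by (intro square_integrable_imp_integrable[OF _ sq]) simp_all
  have prod_int: "integrable M (\<lambda>\<omega>. X i \<omega> * X j \<omega>)" if "i \<in> I" "j \<in> I" for i j
    using that by (intro integrable_mult_of_squares sq) simp_all
  define Y where "Y i \<omega> = X i \<omega> - expectation (X i)" for i \<omega>
  have Yint: "integrable M (\<lambda>\<omega>. Y i \<omega> * Y j \<omega>)" if "i \<in> I" "j \<in> I" for i j
    using that int prod_int unfolding Y_def
    by (simp add: left_diff_distrib right_diff_distrib)
  have cov: "expectation (\<lambda>\<omega>. Y i \<omega> * Y j \<omega>) = (if i = j then variance (X i) else 0)"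
    if ij: "i \<in> I" "j \<in> I" for i j
  proof (cases "i = j")
    case True
    then show ?thesis by (simp add: Y_def power2_eq_square)
  next
    case False
    have "indep_vars (\<lambda>_. borel) X {i, j}"
      using ind ij by (intro indep_vars_subset[OF ind]) auto
    then have "expectation (\<lambda>\<omega>. \<Prod>k\<in>{i, j}. X k \<omega>) = (\<Prod>k\<in>{i, j}. expectation (X k))"
      using int ij by (intro indep_vars_lebesgue_integral) auto
    then have "expectation (\<lambda>\<omega>. X i \<omega> * X j \<omega>) = expectation (X i) * expectation (X j)"
      using False by simp
    then show ?thesis
      using False ij int prod_int unfolding Y_def
      by (simp add: left_diff_distrib right_diff_distrib prob_space)
  qed
  have "variance (\<lambda>\<omega>. \<Sum>i\<in>I. X i \<omega>) = expectation (\<lambda>\<omega>. \<Sum>i\<in>I. \<Sum>j\<in>I. Y i \<omega> * Y j \<omega>)"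
    by (simp add: Bochner_Integration.integral_sum int Y_def sum_subtractf power2_eq_square
        flip: sum_product)
  also have "\<dots> = (\<Sum>i\<in>I. \<Sum>j\<in>I. if i = j then variance (X i) else 0)"
    by (simp add: Bochner_Integration.integral_sum Yint cov)
  also have "\<dots> = (\<Sum>i\<in>I. variance (X i))"
    using I by simp
  finally show ?thesis .
qed

end

lemma (in prob_space) variance_cong_AE:
  fixes f g :: "'a \<Rightarrow> real"
  assumes "f \<in> borel_measurable M" "g \<in> borel_measurable M" "AE \<omega> in M. f \<omega> = g \<omega>"
  shows "variance f = variance g"
proof -
  have "expectation f = expectation g"
    using assms by (intro integral_cong_AE)
  with assms show ?thesis
    by (intro integral_cong_AE) auto
qed

text \<open>The parallel axis identity. With c = e it splits the variation of the instruments of a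
  cluster into a part within the cluster and the part of the cluster mean.\<close>

lemma sum_deviation_squares:
  fixes x :: "'i \<Rightarrow> real"
  assumes "finite I" "I \<noteq> {}"
  shows "(\<Sum>i\<in>I. (x i - sum x I / card I)\<^sup>2)
    = (\<Sum>i\<in>I. (x i - c)\<^sup>2) - card I * (sum x I / card I - c)\<^sup>2"
proof -
  define m where "m = sum x I / card I"
  have m: "(\<Sum>i\<in>I. x i) = card I * m"
    using assms by (simp add: m_def)
  have "(\<Sum>i\<in>I. (x i - c)\<^sup>2)
      = (\<Sum>i\<in>I. (x i - m)\<^sup>2 + 2 * (m - c) * x i + (c\<^sup>2 - m\<^sup>2))"
    by (intro sum.cong refl) (simp add: power2_eq_square algebra_simps)
  also have "\<dots> = (\<Sum>i\<in>I. (x i - m)\<^sup>2) + 2 * (m - c) * (card I * m) + card I * (c\<^sup>2 - m\<^sup>2)"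
    by (simp add: sum.distrib m flip: sum_distrib_left)
  finally show ?thesis
    unfolding m_def[symmetric] by (simp add: power2_eq_square algebra_simps)
qed

section \<open>The net outcome in terms of the potentials\<close>

text \<open>This is A with the instrument set to 0: \<open>fst (fst (snd p))\<close> is D(0), and
  the branches are Y(0,1) - t and Y(0,0). Being a function of the potentials alone, it inherits
  their independence of the instruments.\<close>

definition adjusted_outcome :: "real \<Rightarrow> ('p::finite) potentials \<Rightarrow> real" where
  "adjusted_outcome t p =
    (if fst (fst (snd p)) then fst (snd (fst p)) - t else fst (fst p))"

lemma fst_potentials_measurable[measurable]: "fst \<in> measurable potentials_space borel"
  and treatments_measurable[measurable]:
    "(\<lambda>p. fst (snd p)) \<in> measurable potentials_space (count_space UNIV)"
  unfolding potentials_space_def by measurable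

text \<open>The four outcomes carry the Borel sigma-algebra of the product topology, not a product
  of sigma-algebras, so the projections are measurable by continuity.\<close>

lemma outcome_projections_measurable[measurable]:
  "fst \<in> borel_measurable (borel :: (real \<times> real \<times> real \<times> real) measure)"
  "(\<lambda>y. fst (snd y)) \<in> borel_measurable (borel :: (real \<times> real \<times> real \<times> real) measure)"
  "(\<lambda>y. fst (snd (snd y))) \<in> borel_measurable (borel :: (real \<times> real \<times> real \<times> real) measure)"
  "(\<lambda>y. snd (snd (snd y))) \<in> borel_measurable (borel :: (real \<times> real \<times> real \<times> real) measure)"
  by (intro borel_measurable_continuous_onI continuous_intros)+

lemma adjusted_outcome_measurable[measurable]:
  "adjusted_outcome t \<in> borel_measurable potentials_space"
proof -
  have [measurable]:
    "(\<lambda>p. fst (fst (snd p))) \<in> measurable potentials_space (count_space UNIV)"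
    "(\<lambda>p. fst (fst p)) \<in> borel_measurable potentials_space"
    "(\<lambda>p. fst (snd (fst p))) \<in> borel_measurable potentials_space"
    using measurable_compose[OF treatments_measurable, of fst "count_space UNIV"]
      measurable_compose[OF fst_potentials_measurable] outcome_projections_measurable
    by auto
  show ?thesis
    unfolding adjusted_outcome_def[abs_def] by measurable
qed

lemma finite_cluster_units[simp]: "finite (cluster_units P g)"
  and card_cluster_units[simp]: "card (cluster_units P g) = csize P g"
  and fst_cluster_units: "i \<in> cluster_units P g \<Longrightarrow> fst i = g"
  by (auto simp: cluster_units_def card_cartesian_product)

lemma cluster_units_all_units: "g < nclust P \<Longrightarrow> i \<in> cluster_units P g \<Longrightarrow> i \<in> all_units P"
  by (auto simp: all_units_def)

lemma sum_all_units:
  "(\<Sum>i\<in>all_units P. f i) = (\<Sum>g<nclust P. \<Sum>i\<in>cluster_units P g. f i)"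
  unfolding all_units_def
  by (rule sum.UNION_disjoint) (auto simp: cluster_units_def)

section \<open>A single population: measurability and the law of the instrument\<close>

text \<open>Positivity of \<open>kappa\<close> is kept out of the locale: in the regime it is
  derived from the infimum, and that derivation already uses \<open>kappa_nonneg\<close>.\<close>

locale iv_outcome_model =
  fixes P :: "('w, 'p::finite) population"
    and mu_alpha sigma_alpha sigma_eps :: real
  assumes population: "clustered_population P"
    and sampling: "cluster_sampling P"
    and iv: "iv_assumptions P"
    and homogeneous: "homogeneous_clusters P"
    and model: "outcome_model P mu_alpha sigma_alpha sigma_eps"

sublocale iv_outcome_model \<subseteq> prob_space "pmeas P"
  using population by (simp add: clustered_population_def)

context iv_outcome_model
begin

abbreviation Z :: "nat \<times> nat \<Rightarrow> 'w \<Rightarrow> real" where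
  "Z i \<omega> \<equiv> of_bool (zinst P i \<omega>)"

abbreviation var_zbar :: "nat \<Rightarrow> real" where
  "var_zbar g \<equiv> variance (zbar_cluster P g)"

lemma csize_pos: "g < nclust P \<Longrightarrow> 0 < csize P g"
  using population by (auto simp: clustered_population_def)

lemma origin_unit: "(0, 0) \<in> all_units P"
  using population csize_pos[of 0]
  by (auto simp: clustered_population_def all_units_def cluster_units_def)

lemma popsize_pos: "0 < popsize P"
proof -
  have "0 < nclust P"
    using population by (simp add: clustered_population_def)
  then show ?thesis
    unfolding popsize_def by (intro sum_pos2[of _ 0]) (auto simp: csize_pos)
qed

lemma Q_unit_measurable[measurable]: "i \<in> all_units P \<Longrightarrow> Q_unit P i \<in> measurable (pmeas P) Q_space"
  using population by (simp add: clustered_population_def)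

lemma zinst_measurable[measurable]:
  assumes "i \<in> all_units P"
  shows "zinst P i \<in> measurable (pmeas P) (count_space UNIV)"
proof -
  have "(\<lambda>\<omega>. fst (Q_unit P i \<omega>)) \<in> measurable (pmeas P) (count_space UNIV)"
    using Q_unit_measurable[OF assms] unfolding Q_space_def by measurable
  then show ?thesis
    by (simp add: Q_unit_def)
qed

lemma potentials_measurable[measurable]:
  assumes "i \<in> all_units P"
  shows "potentials P i \<in> measurable (pmeas P) potentials_space"
proof -
  have "(\<lambda>\<omega>. snd (Q_unit P i \<omega>)) \<in> measurable (pmeas P) potentials_space"
    using Q_unit_measurable[OF assms] unfolding Q_space_def by measurable
  then show ?thesis
    by (simp add: Q_unit_def)
qed

lemma potential_components_measurable[measurable]:
  assumes "i \<in> all_units P"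
  shows "ypot P i z d \<in> borel_measurable (pmeas P)"
    and "dpot P i z \<in> measurable (pmeas P) (count_space UNIV)"
proof -
  note pot = potentials_measurable[OF assms]
  note outcomes = measurable_compose[OF pot fst_potentials_measurable]
  note treatments = measurable_compose[OF pot treatments_measurable]
  show "ypot P i z d \<in> borel_measurable (pmeas P)"
    using outcome_projections_measurable[THEN measurable_compose[OF outcomes]]
    by (cases z; cases d) (simp_all add: potentials_def)
  show "dpot P i z \<in> measurable (pmeas P) (count_space UNIV)"
    using measurable_compose[OF treatments, of fst "count_space UNIV"]
      measurable_compose[OF treatments, of snd "count_space UNIV"]
    by (cases z) (simp_all add: potentials_def)
qed

text \<open>The observed outcome selects a potential outcome at random indices Z and D(Z). Case
  distinction on these Booleans turns it into conditionals over measurable components.\<close>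

lemma A_unit_measurable[measurable]:
  assumes i[measurable]: "i \<in> all_units P"
  shows "A_unit P i \<in> borel_measurable (pmeas P)"
proof -
  have "A_unit P i = (\<lambda>\<omega>.
      if zinst P i \<omega>
      then (if dpot P i True \<omega> then ypot P i True True \<omega> - tau_c P else ypot P i True False \<omega>)
      else (if dpot P i False \<omega> then ypot P i False True \<omega> - tau_c P else ypot P i False False \<omega>))"
    by (auto simp: A_unit_def y_obs_def d_obs_def fun_eq_iff)
  also have "\<dots> \<in> borel_measurable (pmeas P)"
    by measurable
  finally show ?thesis .
qed

lemma zbar_cluster_measurable[measurable]:
  "g < nclust P \<Longrightarrow> zbar_cluster P g \<in> borel_measurable (pmeas P)"
  unfolding zbar_cluster_def[abs_def]
  by (intro borel_measurable_divide borel_measurable_sum) (auto dest: cluster_units_all_units)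

lemma integrable_Z: "i \<in> all_units P \<Longrightarrow> integrable (pmeas P) (Z i)"
  by (rule integrable_const_bound[where B=1]) auto

text \<open>The instrument is a component of \<open>Q_unit\<close>, whose law is the same for all
  units. This transfers every moment of Z to the reference unit (0, 0), at which e and sigma_Z^2 are
  defined.\<close>

lemma zinst_law:
  fixes f :: "bool \<Rightarrow> real"
  assumes i: "i \<in> all_units P"
  shows "expectation (\<lambda>\<omega>. f (zinst P i \<omega>)) = expectation (\<lambda>\<omega>. f (zinst P (0, 0) \<omega>))"
proof -
  have [measurable]: "(\<lambda>q. f (fst q)) \<in> borel_measurable Q_space"
    unfolding Q_space_def by measurable
  have "expectation (\<lambda>\<omega>. f (zinst P j \<omega>))
      = (\<integral>q. f (fst q) \<partial>distr (pmeas P) Q_space (Q_unit P j))" if "j \<in> all_units P" for j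
    using that by (subst integral_distr) (auto simp: Q_unit_def)
  with homogeneous i origin_unit show ?thesis
    by (metis homogeneous_clusters_def)
qed

lemma expectation_Z: "i \<in> all_units P \<Longrightarrow> expectation (Z i) = z_prob P"
proof -
  assume "i \<in> all_units P"
  then have "expectation (Z i) = expectation (Z (0, 0))"
    by (rule zinst_law)
  also have "\<dots> = expectation (indicator {\<omega> \<in> space (pmeas P). zinst P (0, 0) \<omega>})"
    by (intro Bochner_Integration.integral_cong) (auto simp: indicator_def)
  also have "\<dots> = z_prob P"
    using zinst_measurable[OF origin_unit] by (simp add: z_prob_def)
  finally show ?thesis .
qed

lemma variance_Z:
  assumes "i \<in> all_units P"
  shows "expectation (\<lambda>\<omega>. (Z i \<omega> - z_prob P)\<^sup>2) = sigma2_Z P"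
  using zinst_law[OF assms, of "\<lambda>b. (of_bool b - z_prob P)\<^sup>2"]
  by (simp add: sigma2_Z_def expectation_Z[OF origin_unit])

lemma sigma2_Z_pos: "0 < sigma2_Z P"
proof -
  \<comment> \<open>Since Z is 0 or 1, Z^2 = Z makes the square affine in Z; this yields the
    Bernoulli variance e (1 - e).\<close>
  have "sigma2_Z P = expectation (\<lambda>\<omega>. (1 - 2 * z_prob P) * Z (0, 0) \<omega> + (z_prob P)\<^sup>2)"
    unfolding variance_Z[OF origin_unit, symmetric]
    by (intro Bochner_Integration.integral_cong refl) (auto simp: power2_eq_square algebra_simps)
  also have "\<dots> = z_prob P * (1 - z_prob P)"
    using integrable_Z[OF origin_unit] expectation_Z[OF origin_unit]
    by (simp add: prob_space power2_eq_square algebra_simps)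
  finally show ?thesis
    using iv origin_unit by (auto simp: iv_assumptions_def z_prob_def)
qed

text \<open>Under monotonicity D(1) - D(0) is almost surely the indicator of a complier. If
  compliers had probability 0, its mean would vanish, contrary to relevance of the
  instrument.\<close>

lemma pi_c_pos: "0 < pi_c P"
proof (rule ccontr)
  assume "\<not> 0 < pi_c P"
  then have "measure (pmeas P) (complier_event P) = 0"
    by (simp add: pi_c_def order_less_le)
  moreover have ev: "complier_event P
      = {\<omega> \<in> space (pmeas P). dpot P (0, 0) True \<omega> \<and> \<not> dpot P (0, 0) False \<omega>}"
    by (auto simp: complier_event_def ctype_def split: if_splits)
  then have "complier_event P \<in> events"
    using potential_components_measurable(2)[OF origin_unit] by simp
  ultimately have "AE \<omega> in pmeas P. \<omega> \<notin> complier_event P"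
    using prob_eq_0 by blast
  moreover have "AE \<omega> in pmeas P. dpot P (0, 0) False \<omega> \<le> dpot P (0, 0) True \<omega>"
    using iv origin_unit by (auto simp: iv_assumptions_def)
  ultimately have "AE \<omega> in pmeas P.
      of_bool (dpot P (0, 0) True \<omega>) - of_bool (dpot P (0, 0) False \<omega>) = (0::real)"
    by (rule AE_mp[OF AE_conjI]) (auto intro!: AE_I2 simp: ev)
  then have "expectation (\<lambda>\<omega>. of_bool (dpot P (0, 0) True \<omega>) - of_bool (dpot P (0, 0) False \<omega>)) = (0::real)"
    by (rule integral_eq_zero_AE)
  then show False
    using iv origin_unit by (auto simp: iv_assumptions_def)
qed

text \<open>
  Monotonicity makes every treated unit with z = 0 an always-taker, and a complier's net outcome
  does not change with its treatment; so A does not depend on the instrument at all.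
\<close>

lemma A_unit_eq_adjusted_outcome:
  assumes i: "i \<in> all_units P"
  shows "AE \<omega> in pmeas P. A_unit P i \<omega> = adjusted_outcome (tau_c P) (potentials P i \<omega>)"
proof -
  have "AE \<omega> in pmeas P. ypot P i False d \<omega> = ypot P i True d \<omega>" for d
    using iv i by (auto simp: iv_assumptions_def)
  from this[of True] this[of False]
  have "AE \<omega> in pmeas P. \<forall>d. ypot P i False d \<omega> = ypot P i True d \<omega>"
    by eventually_elim (metis (full_types))
  moreover have "AE \<omega> in pmeas P. dpot P i False \<omega> \<le> dpot P i True \<omega>"
    using iv i by (auto simp: iv_assumptions_def)
  moreover have "AE \<omega> in pmeas P. ctype P i \<omega> = Complier \<longrightarrow> unit_effect P i \<omega> = tau_c P"
    using model i by (auto simp: outcome_model_def)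
  ultimately show ?thesis
  proof eventually_elim
    case (elim \<omega>)
    then show ?case
      by (cases "zinst P i \<omega>"; cases "dpot P i True \<omega>"; cases "dpot P i False \<omega>")
        (auto simp: A_unit_def y_obs_def d_obs_def adjusted_outcome_def potentials_def
          ctype_def unit_effect_def)
  qed
qed

section \<open>Moments of the net outcome under the outcome model\<close>

lemma A_unit_eq_alpha_plus_eps:
  assumes g: "g < nclust P" and i: "i \<in> cluster_units P g"
  shows "AE \<omega> in pmeas P. A_unit P i \<omega> = alpha P g \<omega> + eps P i \<omega>"
proof -
  have "AE \<omega> in pmeas P.
      y_obs P i \<omega> = of_bool (d_obs P i \<omega>) * tau_c P + alpha P (fst i) \<omega> + eps P i \<omega>"
    using model cluster_units_all_units[OF g i] by (auto simp: outcome_model_def)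
  then show ?thesis
    by eventually_elim (simp add: A_unit_def fst_cluster_units[OF i])
qed

lemma alpha_props:
  assumes "g < nclust P"
  shows alpha_measurable[measurable]: "alpha P g \<in> borel_measurable (pmeas P)"
    and "integrable (pmeas P) (\<lambda>\<omega>. (alpha P g \<omega>)\<^sup>2)"
    and "expectation (alpha P g) = mu_alpha"
    and "variance (alpha P g) = sigma_alpha\<^sup>2"
  using model assms by (auto simp: outcome_model_def)

lemma eps_props:
  assumes "i \<in> all_units P"
  shows eps_measurable[measurable]: "eps P i \<in> borel_measurable (pmeas P)"
    and "integrable (pmeas P) (\<lambda>\<omega>. (eps P i \<omega>)\<^sup>2)"
    and "integrable (pmeas P) (eps P i)"
proof -
  show "eps P i \<in> borel_measurable (pmeas P)" "integrable (pmeas P) (\<lambda>\<omega>. (eps P i \<omega>)\<^sup>2)"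
    using model assms by (auto simp: outcome_model_def)
  then show "integrable (pmeas P) (eps P i)"
    by (rule square_integrable_imp_integrable)
qed

lemma sigma_alg_alpha_subalgebra:
  assumes "g < nclust P"
  shows "finite_measure_subalgebra (pmeas P) (sigma_alg_alpha P g)"
proof
  show "subalgebra (pmeas P) (sigma_alg_alpha P g)"
    using measurable_sets[OF alpha_measurable[OF assms]]
    by (auto simp: subalgebra_def sigma_alg_alpha_def sets_vimage_algebra2)
qed

text \<open>The conditional moments given alpha_g are integrated out by the tower property. For the
  mixed moment, alpha_g is measurable for its own sigma-algebra and can be pulled out of the
  conditional expectation, leaving a factor that is zero.\<close>

lemma alpha_eps_moments:
  assumes g: "g < nclust P" and i: "i \<in> cluster_units P g" and j: "j \<in> cluster_units P g"
  shows expectation_eps: "expectation (eps P i) = 0"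
    and expectation_alpha_eps: "expectation (\<lambda>\<omega>. alpha P g \<omega> * eps P i \<omega>) = 0"
    and expectation_eps_eps:
      "expectation (\<lambda>\<omega>. eps P i \<omega> * eps P j \<omega>) = (if i = j then sigma_eps\<^sup>2 else 0)"
proof -
  let ?F = "sigma_alg_alpha P g"
  interpret F: finite_measure_subalgebra "pmeas P" ?F
    by (rule sigma_alg_alpha_subalgebra[OF g])
  have units: "i \<in> all_units P" "j \<in> all_units P"
    using g i j by (auto intro: cluster_units_all_units)
  note [measurable] = alpha_measurable[OF g] units[THEN eps_measurable]
  have zero: "AE \<omega> in pmeas P. real_cond_exp (pmeas P) ?F (eps P i) \<omega> = 0"
    "AE \<omega> in pmeas P. real_cond_exp (pmeas P) ?F (eps P j) \<omega> = 0"
    using model g i j by (auto simp: outcome_model_def)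
  show "expectation (eps P i) = 0"
    using F.real_cond_exp_int(2)[OF eps_props(3)[OF units(1)]] zero(1)
    by (simp add: integral_eq_zero_AE)
  have alpha_F: "alpha P g \<in> borel_measurable ?F"
    unfolding sigma_alg_alpha_def by (intro measurable_vimage_algebra1) simp
  have "integrable (pmeas P) (\<lambda>\<omega>. alpha P g \<omega> * eps P i \<omega>)"
    using alpha_props(2)[OF g] eps_props(2)[OF units(1)]
    by (intro integrable_mult_of_squares) simp_all
  from F.real_cond_exp_intg(2)[OF this alpha_F]
  have "expectation (\<lambda>\<omega>. alpha P g \<omega> * eps P i \<omega>)
      = expectation (\<lambda>\<omega>. alpha P g \<omega> * real_cond_exp (pmeas P) ?F (eps P i) \<omega>)"
    by simp
  also have "\<dots> = 0"
    using zero(1) by (intro integral_eq_zero_AE) auto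
  finally show "expectation (\<lambda>\<omega>. alpha P g \<omega> * eps P i \<omega>) = 0" .
  \<comment> \<open>\<open>cond_cov\<close> centres at the conditional means. These vanish almost
    surely, so the centred product agrees almost surely with the plain one.\<close>
  let ?r = "\<lambda>\<omega>. (eps P i \<omega> - real_cond_exp (pmeas P) ?F (eps P i) \<omega>)
    * (eps P j \<omega> - real_cond_exp (pmeas P) ?F (eps P j) \<omega>)"
  have r: "AE \<omega> in pmeas P. eps P i \<omega> * eps P j \<omega> = ?r \<omega>"
    using zero by eventually_elim simp
  have int: "integrable (pmeas P) (\<lambda>\<omega>. eps P i \<omega> * eps P j \<omega>)"
    using units by (intro integrable_mult_of_squares eps_props)
  then have int_r: "integrable (pmeas P) ?r"
    using r by (subst integrable_cong_AE[where g="\<lambda>\<omega>. eps P i \<omega> * eps P j \<omega>"]) auto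
  have "expectation (\<lambda>\<omega>. eps P i \<omega> * eps P j \<omega>) = expectation ?r"
    using r by (intro integral_cong_AE) simp_all
  also have "\<dots> = expectation (cond_cov (pmeas P) ?F (eps P i) (eps P j))"
    unfolding cond_cov_def using F.real_cond_exp_int(2)[OF int_r] by simp
  also have "\<dots> = expectation (\<lambda>_. if i = j then sigma_eps\<^sup>2 else 0)"
    using model g i j unfolding cond_cov_def
    by (intro integral_cong_AE) (auto simp: outcome_model_def cond_cov_def)
  finally show "expectation (\<lambda>\<omega>. eps P i \<omega> * eps P j \<omega>) = (if i = j then sigma_eps\<^sup>2 else 0)"
    by (simp add: prob_space)
qed

text \<open>All units of a cluster share alpha_g, which contributes its variance to every pair; the
  errors are uncorrelated with it and with each other, so they contribute on the diagonal
  only.\<close>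

lemma A_unit_moments:
  assumes g: "g < nclust P" and i: "i \<in> cluster_units P g" and j: "j \<in> cluster_units P g"
  shows expectation_A_unit: "expectation (A_unit P i) = mu_alpha"
    and square_integrable_A_unit: "integrable (pmeas P) (\<lambda>\<omega>. (A_unit P i \<omega> - mu_alpha)\<^sup>2)"
    and covariance_A_unit:
      "expectation (\<lambda>\<omega>. (A_unit P i \<omega> - mu_alpha) * (A_unit P j \<omega> - mu_alpha))
        = sigma_alpha\<^sup>2 + (if i = j then sigma_eps\<^sup>2 else 0)"
proof -
  have units: "i \<in> all_units P" "j \<in> all_units P"
    using g i j by (auto intro: cluster_units_all_units)
  note [measurable] = alpha_measurable[OF g] units[THEN eps_measurable] units[THEN A_unit_measurable]
  note A = A_unit_eq_alpha_plus_eps[OF g i] A_unit_eq_alpha_plus_eps[OF g j]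
  have alpha: "integrable (pmeas P) (alpha P g)"
    by (rule square_integrable_imp_integrable[OF alpha_props(1,2)[OF g]])
  note eps = eps_props(3)[OF units(1)] eps_props(3)[OF units(2)]
  have ints: "integrable (pmeas P) (\<lambda>\<omega>. alpha P g \<omega> * alpha P g \<omega>)"
    "integrable (pmeas P) (\<lambda>\<omega>. alpha P g \<omega> * eps P i \<omega>)"
    "integrable (pmeas P) (\<lambda>\<omega>. alpha P g \<omega> * eps P j \<omega>)"
    "integrable (pmeas P) (\<lambda>\<omega>. eps P i \<omega> * eps P j \<omega>)"
    "integrable (pmeas P) (\<lambda>\<omega>. eps P i \<omega> * eps P i \<omega>)"
    using alpha_props(2)[OF g] eps_props(2)[OF units(1)] eps_props(2)[OF units(2)]
    by (auto intro!: integrable_mult_of_squares)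
  have "expectation (A_unit P i) = expectation (\<lambda>\<omega>. alpha P g \<omega> + eps P i \<omega>)"
    using A(1) by (intro integral_cong_AE) simp_all
  also have "\<dots> = mu_alpha"
    using alpha eps by (simp add: alpha_props(3)[OF g] expectation_eps[OF g i i])
  finally show "expectation (A_unit P i) = mu_alpha" .
  have "integrable (pmeas P) (\<lambda>\<omega>. (alpha P g \<omega> + eps P i \<omega> - mu_alpha)\<^sup>2)"
    using ints alpha eps by (simp add: power2_eq_square algebra_simps)
  then show "integrable (pmeas P) (\<lambda>\<omega>. (A_unit P i \<omega> - mu_alpha)\<^sup>2)"
    using A(1) by (subst integrable_cong_AE[where
          g="\<lambda>\<omega>. (alpha P g \<omega> + eps P i \<omega> - mu_alpha)\<^sup>2"]) auto
  have aa: "expectation (\<lambda>\<omega>. (alpha P g \<omega> - mu_alpha)\<^sup>2) = sigma_alpha\<^sup>2"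
    using alpha_props(3,4)[OF g] by simp
  have aa_int: "integrable (pmeas P) (\<lambda>\<omega>. (alpha P g \<omega> - mu_alpha)\<^sup>2)"
    using ints alpha by (simp add: power2_eq_square algebra_simps)
  \<comment> \<open>The square of alpha_g - \<open>mu_alpha\<close> stays unexpanded because its
    mean is the given variance. Of the remaining terms only the product of the two errors can have a
    nonzero mean.\<close>
  have "expectation (\<lambda>\<omega>. (A_unit P i \<omega> - mu_alpha) * (A_unit P j \<omega> - mu_alpha))
      = expectation (\<lambda>\<omega>. (alpha P g \<omega> - mu_alpha)\<^sup>2 + alpha P g \<omega> * eps P i \<omega>
          + alpha P g \<omega> * eps P j \<omega> - mu_alpha * eps P i \<omega> - mu_alpha * eps P j \<omega>
          + eps P i \<omega> * eps P j \<omega>)"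
    using A by (intro integral_cong_AE) (auto simp: power2_eq_square algebra_simps)
  also have "\<dots> = sigma_alpha\<^sup>2 + (if i = j then sigma_eps\<^sup>2 else 0)"
    using ints eps aa_int
    by (simp add: aa expectation_eps[OF g i j] expectation_eps[OF g j i]
        expectation_alpha_eps[OF g i j] expectation_alpha_eps[OF g j i]
        expectation_eps_eps[OF g i j])
  finally show "expectation (\<lambda>\<omega>. (A_unit P i \<omega> - mu_alpha) * (A_unit P j \<omega> - mu_alpha))
        = sigma_alpha\<^sup>2 + (if i = j then sigma_eps\<^sup>2 else 0)" .
qed

lemma mu_A_eq: "mu_A P = mu_alpha"
proof -
  have "0 < nclust P" "(0, 0) \<in> cluster_units P 0"
    using origin_unit by (auto simp: all_units_def cluster_units_def)
  then show ?thesis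
    unfolding mu_A_def by (intro expectation_A_unit)
qed

section \<open>Variances of the cluster sums\<close>

text \<open>Here the two representations of A meet: the sum is rewritten almost surely with
  functions \<open>b\<close> of the potentials, which are independent of the instruments, while the
  moments of \<open>b\<close> are carried over from \<open>A_unit\<close>. The weights are given as
  functions of the instrument vector of the cluster since independence is available for that
  vector.\<close>

lemma variance_cluster_weighted_sum:
  assumes g: "g < nclust P"
    and w: "\<And>i. i \<in> cluster_units P g \<Longrightarrow>
      w i \<in> borel_measurable (PiM (cluster_units P g) (\<lambda>_. count_space UNIV))"
    and bound: "\<And>i z. i \<in> cluster_units P g \<Longrightarrow> \<bar>w i z\<bar> \<le> c"
  defines "W \<equiv> \<lambda>i \<omega>. w i (\<lambda>j\<in>cluster_units P g. zinst P j \<omega>)"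
  shows "variance (\<lambda>\<omega>. \<Sum>i\<in>cluster_units P g. W i \<omega> * (A_unit P i \<omega> - mu_A P))
    = sigma_alpha\<^sup>2 * expectation (\<lambda>\<omega>. (\<Sum>i\<in>cluster_units P g. W i \<omega>)\<^sup>2)
      + sigma_eps\<^sup>2 * (\<Sum>i\<in>cluster_units P g. expectation (\<lambda>\<omega>. (W i \<omega>)\<^sup>2))"
proof -
  let ?C = "cluster_units P g"
  define Y where "Y = (\<lambda>\<omega>. \<lambda>i\<in>?C. potentials P i \<omega>)"
  define b where "b = (\<lambda>(i :: nat \<times> nat) p. adjusted_outcome (tau_c P) (p i :: 'p potentials) - mu_alpha)"
  have ind: "indep_rv (pmeas P) (PiM ?C (\<lambda>_. count_space UNIV))
      (\<lambda>\<omega>. \<lambda>i\<in>?C. zinst P i \<omega>) (PiM ?C (\<lambda>_. potentials_space)) Y"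
    using iv g unfolding Y_def by (simp add: iv_assumptions_def)
  then have [measurable]: "(\<lambda>\<omega>. \<lambda>i\<in>?C. zinst P i \<omega>) \<in> measurable (pmeas P) (PiM ?C (\<lambda>_. count_space UNIV))"
    "Y \<in> measurable (pmeas P) (PiM ?C (\<lambda>_. potentials_space))"
    by (auto simp: indep_rv_def)
  have b_meas[measurable]: "b i \<in> borel_measurable (PiM ?C (\<lambda>_. potentials_space))" if "i \<in> ?C" for i
    unfolding b_def using that by measurable
  have bY_meas[measurable]: "(\<lambda>\<omega>. b i (Y \<omega>)) \<in> borel_measurable (pmeas P)" if "i \<in> ?C" for i
    using that by measurable
  have W_meas[measurable]: "W i \<in> borel_measurable (pmeas P)" if "i \<in> ?C" for i
    unfolding W_def using w[OF that] by measurable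
  have A_meas[measurable]: "A_unit P i \<in> borel_measurable (pmeas P)" if "i \<in> ?C" for i
    using that g by (intro A_unit_measurable cluster_units_all_units)
  have b_eq: "AE \<omega> in pmeas P. b i (Y \<omega>) = A_unit P i \<omega> - mu_alpha" if "i \<in> ?C" for i
    using A_unit_eq_adjusted_outcome[OF cluster_units_all_units[OF g that]]
    by eventually_elim (simp add: b_def Y_def that)
  have "variance (\<lambda>\<omega>. \<Sum>i\<in>?C. W i \<omega> * (A_unit P i \<omega> - mu_A P))
      = variance (\<lambda>\<omega>. \<Sum>i\<in>?C. W i \<omega> * b i (Y \<omega>))"
  proof (rule variance_cong_AE)
    have "AE \<omega> in pmeas P. \<forall>i\<in>?C. b i (Y \<omega>) = A_unit P i \<omega> - mu_alpha"
      using b_eq by (simp add: AE_finite_all)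
    then show "AE \<omega> in pmeas P.
        (\<Sum>i\<in>?C. W i \<omega> * (A_unit P i \<omega> - mu_A P)) = (\<Sum>i\<in>?C. W i \<omega> * b i (Y \<omega>))"
      by eventually_elim (simp add: mu_A_eq)
  qed (intro borel_measurable_sum borel_measurable_times borel_measurable_diff
      W_meas A_meas bY_meas borel_measurable_const; assumption)+
  also have "\<dots> = sigma_alpha\<^sup>2 * expectation (\<lambda>\<omega>. (\<Sum>i\<in>?C. W i \<omega>)\<^sup>2)
      + sigma_eps\<^sup>2 * (\<Sum>i\<in>?C. expectation (\<lambda>\<omega>. (W i \<omega>)\<^sup>2))"
    unfolding W_def
  proof (rule variance_sum_mult_exchangeable[OF ind finite_cluster_units w bound b_meas])
    fix i assume i: "i \<in> ?C"
    show "integrable (pmeas P) (\<lambda>\<omega>. (b i (Y \<omega>))\<^sup>2)"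
      using square_integrable_A_unit[OF g i i] b_eq[OF i] i
      by (subst integrable_cong_AE[where g="\<lambda>\<omega>. (A_unit P i \<omega> - mu_alpha)\<^sup>2"]) auto
    have "integrable (pmeas P) (\<lambda>\<omega>. A_unit P i \<omega> - mu_alpha)"
      using i by (intro square_integrable_imp_integrable[OF _ square_integrable_A_unit[OF g i i]]) simp
    from Bochner_Integration.integrable_add[OF this integrable_const[of mu_alpha]]
    have int: "integrable (pmeas P) (A_unit P i)"
      by simp
    have "expectation (\<lambda>\<omega>. b i (Y \<omega>)) = expectation (\<lambda>\<omega>. A_unit P i \<omega> - mu_alpha)"
      using b_eq[OF i] i by (intro integral_cong_AE) simp_all
    also have "\<dots> = 0"
      using int by (simp add: expectation_A_unit[OF g i i] prob_space)
    finally show "expectation (\<lambda>\<omega>. b i (Y \<omega>)) = 0" .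
  next
    fix i j assume ij: "i \<in> ?C" "j \<in> ?C"
    have "expectation (\<lambda>\<omega>. b i (Y \<omega>) * b j (Y \<omega>))
        = expectation (\<lambda>\<omega>. (A_unit P i \<omega> - mu_alpha) * (A_unit P j \<omega> - mu_alpha))"
      using b_eq[OF ij(1)] b_eq[OF ij(2)] ij by (intro integral_cong_AE) auto
    then show "expectation (\<lambda>\<omega>. b i (Y \<omega>) * b j (Y \<omega>))
        = sigma_alpha\<^sup>2 + (if i = j then sigma_eps\<^sup>2 else 0)"
      by (simp add: covariance_A_unit[OF g ij])
  qed
  finally show ?thesis .
qed

lemma zbar_cluster_bounds: "0 \<le> zbar_cluster P g \<omega>" "zbar_cluster P g \<omega> \<le> 1"
proof -
  have "(\<Sum>i\<in>cluster_units P g. Z i \<omega>) \<le> (\<Sum>i\<in>cluster_units P g. 1)"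
    by (intro sum_mono) simp
  then show "zbar_cluster P g \<omega> \<le> 1"
    by (cases "csize P g = 0") (simp_all add: zbar_cluster_def)
  show "0 \<le> zbar_cluster P g \<omega>"
    by (simp add: zbar_cluster_def sum_nonneg)
qed

lemma integrable_zbar_cluster:
  assumes "g < nclust P"
  shows "integrable (pmeas P) (zbar_cluster P g)"
    and "integrable (pmeas P) (\<lambda>\<omega>. (zbar_cluster P g \<omega>)\<^sup>2)"
proof -
  show "integrable (pmeas P) (zbar_cluster P g)"
    using assms zbar_cluster_bounds by (intro integrable_const_bound[where B=1]) auto
  show "integrable (pmeas P) (\<lambda>\<omega>. (zbar_cluster P g \<omega>)\<^sup>2)"
    using assms zbar_cluster_bounds
    by (intro integrable_const_bound[where B=1]) (auto simp: power_le_one)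
qed

lemma sum_Z: "g < nclust P \<Longrightarrow> (\<Sum>i\<in>cluster_units P g. Z i \<omega>) = csize P g * zbar_cluster P g \<omega>"
  using csize_pos[of g] by (simp add: zbar_cluster_def)

lemma expectation_zbar_cluster:
  assumes g: "g < nclust P"
  shows "expectation (zbar_cluster P g) = z_prob P"
proof -
  have "expectation (\<lambda>\<omega>. \<Sum>i\<in>cluster_units P g. Z i \<omega>) = csize P g * z_prob P"
    using cluster_units_all_units[OF g]
    by (subst Bochner_Integration.integral_sum) (auto simp: integrable_Z expectation_Z)
  then show ?thesis
    using csize_pos[OF g] by (simp add: zbar_cluster_def[abs_def] integral_divide_zero)
qed

lemma integrable_deviation_squares:
  assumes g: "g < nclust P" and i: "i \<in> cluster_units P g"
  shows "integrable (pmeas P) (\<lambda>\<omega>. (Z i \<omega> - z_prob P)\<^sup>2)"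
    and "integrable (pmeas P) (\<lambda>\<omega>. (Z i \<omega> - zbar_cluster P g \<omega>)\<^sup>2)"
proof -
  have u[measurable]: "i \<in> all_units P"
    using cluster_units_all_units[OF g i] .
  note [measurable] = zbar_cluster_measurable[OF g]
  have "(Z i \<omega> - z_prob P)\<^sup>2 \<le> 1" "(Z i \<omega> - zbar_cluster P g \<omega>)\<^sup>2 \<le> 1" for \<omega>
  proof -
    have "\<bar>Z i \<omega> - z_prob P\<bar> \<le> 1"
      by (auto simp: z_prob_def of_bool_def)
    then show "(Z i \<omega> - z_prob P)\<^sup>2 \<le> 1"
      by (simp add: abs_square_le_1)
    have "\<bar>Z i \<omega> - zbar_cluster P g \<omega>\<bar> \<le> 1"
      using zbar_cluster_bounds[of g \<omega>] by (auto simp: of_bool_def)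
    then show "(Z i \<omega> - zbar_cluster P g \<omega>)\<^sup>2 \<le> 1"
      by (simp add: abs_square_le_1)
  qed
  then show "integrable (pmeas P) (\<lambda>\<omega>. (Z i \<omega> - z_prob P)\<^sup>2)"
    and "integrable (pmeas P) (\<lambda>\<omega>. (Z i \<omega> - zbar_cluster P g \<omega>)\<^sup>2)"
    by (auto intro!: integrable_const_bound[where B=1])
qed

text \<open>Total minus between variation around the common mean e of all the Z_i and of zbar_g. It
  serves to find kappa_N = 1 when the cluster means are constant.\<close>

lemma expectation_within_squares:
  assumes g: "g < nclust P"
  shows "(\<Sum>i\<in>cluster_units P g. expectation (\<lambda>\<omega>. (Z i \<omega> - zbar_cluster P g \<omega>)\<^sup>2))
    = csize P g * sigma2_Z P - csize P g * var_zbar g"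
proof -
  let ?C = "cluster_units P g"
  have ne: "?C \<noteq> {}"
    using csize_pos[OF g] by (auto simp: cluster_units_def)
  have int_bar: "integrable (pmeas P) (\<lambda>\<omega>. (zbar_cluster P g \<omega> - z_prob P)\<^sup>2)"
    using integrable_zbar_cluster[OF g] by (simp add: power2_eq_square algebra_simps)
  have "(\<Sum>i\<in>?C. expectation (\<lambda>\<omega>. (Z i \<omega> - zbar_cluster P g \<omega>)\<^sup>2))
      = expectation (\<lambda>\<omega>. \<Sum>i\<in>?C. (Z i \<omega> - zbar_cluster P g \<omega>)\<^sup>2)"
    by (simp add: Bochner_Integration.integral_sum integrable_deviation_squares[OF g])
  also have "\<dots> = expectation (\<lambda>\<omega>. (\<Sum>i\<in>?C. (Z i \<omega> - z_prob P)\<^sup>2)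
      - csize P g * (zbar_cluster P g \<omega> - z_prob P)\<^sup>2)"
    using sum_deviation_squares[OF finite_cluster_units ne, of "\<lambda>i. Z i _" "z_prob P"]
    by (simp add: zbar_cluster_def)
  also have "\<dots> = (\<Sum>i\<in>?C. sigma2_Z P) - csize P g * var_zbar g"
    using int_bar cluster_units_all_units[OF g]
    by (simp add: Bochner_Integration.integral_sum integrable_deviation_squares[OF g]
        expectation_zbar_cluster[OF g] variance_Z)
  finally show ?thesis
    by simp
qed

text \<open>The centred instruments add up to n_g (zbar_g - e). Hence the cluster effect enters with
  n_g^2 var(zbar_g), whatever the dependence among the instruments.\<close>

lemma variance_2sls_cluster:
  assumes g: "g < nclust P"
  shows "variance (\<lambda>\<omega>. \<Sum>i\<in>cluster_units P g. (Z i \<omega> - z_prob P) * (A_unit P i \<omega> - mu_A P))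
    = sigma_alpha\<^sup>2 * ((csize P g)\<^sup>2 * var_zbar g) + sigma_eps\<^sup>2 * (csize P g * sigma2_Z P)"
proof -
  let ?C = "cluster_units P g"
  have "variance (\<lambda>\<omega>. \<Sum>i\<in>?C. (Z i \<omega> - z_prob P) * (A_unit P i \<omega> - mu_A P))
    = sigma_alpha\<^sup>2 * expectation (\<lambda>\<omega>. (\<Sum>i\<in>?C. Z i \<omega> - z_prob P)\<^sup>2)
      + sigma_eps\<^sup>2 * (\<Sum>i\<in>?C. expectation (\<lambda>\<omega>. (Z i \<omega> - z_prob P)\<^sup>2))"
    using variance_cluster_weighted_sum[OF g, of "\<lambda>i z. of_bool (z i) - z_prob P" 1]
    by (auto simp: z_prob_def of_bool_def cong: sum.cong)
  also have "(\<Sum>i\<in>?C. expectation (\<lambda>\<omega>. (Z i \<omega> - z_prob P)\<^sup>2)) = csize P g * sigma2_Z P"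
    by (simp add: variance_Z cluster_units_all_units[OF g])
  also have "(\<lambda>\<omega>. (\<Sum>i\<in>?C. Z i \<omega> - z_prob P)\<^sup>2)
      = (\<lambda>\<omega>. (csize P g)\<^sup>2 * (zbar_cluster P g \<omega> - z_prob P)\<^sup>2)"
    by (simp add: sum_subtractf sum_Z[OF g] power_mult_distrib del: sum_of_bool_eq
        flip: right_diff_distrib)
  finally show ?thesis
    by (simp add: expectation_zbar_cluster[OF g])
qed

lemma variance_2sfe_cluster:
  assumes g: "g < nclust P"
  shows "variance (\<lambda>\<omega>. \<Sum>i\<in>cluster_units P g.
      (Z i \<omega> - zbar_cluster P g \<omega>) * (A_unit P i \<omega> - Abar_cluster P g \<omega>))
    = sigma_eps\<^sup>2
      * (\<Sum>i\<in>cluster_units P g. expectation (\<lambda>\<omega>. (Z i \<omega> - zbar_cluster P g \<omega>)\<^sup>2))"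
proof -
  let ?C = "cluster_units P g"
  define w where "w = (\<lambda>i z. of_bool (z i) - (\<Sum>j\<in>?C. of_bool (z j)) / real (csize P g))"
  have W: "w i (\<lambda>j\<in>?C. zinst P j \<omega>) = Z i \<omega> - zbar_cluster P g \<omega>" if "i \<in> ?C" for i \<omega>
    using that by (simp add: w_def zbar_cluster_def del: sum_of_bool_eq cong: sum.cong)
  have bound: "\<bar>w i z\<bar> \<le> 1" for i z
  proof -
    have "(\<Sum>j\<in>?C. of_bool (z j)) \<le> (\<Sum>j\<in>?C. 1 :: real)" "0 \<le> (\<Sum>j\<in>?C. of_bool (z j) :: real)"
      by (intro sum_mono sum_nonneg; simp)+
    then have "0 \<le> (\<Sum>j\<in>?C. of_bool (z j)) / real (csize P g)"
      "(\<Sum>j\<in>?C. of_bool (z j)) / real (csize P g) \<le> 1"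
      using csize_pos[OF g] by simp_all
    then show ?thesis
      by (auto simp: w_def of_bool_def)
  qed
  have w: "w i \<in> borel_measurable (PiM ?C (\<lambda>_. count_space UNIV))" if "i \<in> ?C" for i
    unfolding w_def using that by measurable
  \<comment> \<open>This removes the cluster effect: the coefficient of \<open>sigma_alpha\<close>
    squared is the second moment of this sum.\<close>
  have zero: "(\<Sum>i\<in>?C. Z i \<omega> - zbar_cluster P g \<omega>) = 0" for \<omega>
    by (simp add: sum_subtractf sum_Z[OF g] del: sum_of_bool_eq)
  \<comment> \<open>Weights with sum zero do not see the centring of A. As a may vary with the
    outcome of the experiment, both the random \<open>Abar_cluster\<close> and the constant
    \<open>mu_A\<close> are covered, which leads back to the lemma for \<open>mu_A\<close>.\<close>
  have shift: "(\<Sum>i\<in>?C. (Z i \<omega> - zbar_cluster P g \<omega>) * (A_unit P i \<omega> - a)) =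
      (\<Sum>i\<in>?C. (Z i \<omega> - zbar_cluster P g \<omega>) * A_unit P i \<omega>)" for a \<omega>
  proof -
    have "(\<Sum>i\<in>?C. (Z i \<omega> - zbar_cluster P g \<omega>) * (A_unit P i \<omega> - a)) =
        (\<Sum>i\<in>?C. (Z i \<omega> - zbar_cluster P g \<omega>) * A_unit P i \<omega>)
        - (\<Sum>i\<in>?C. Z i \<omega> - zbar_cluster P g \<omega>) * a"
      unfolding sum_distrib_right sum_subtractf[symmetric]
      by (simp only: right_diff_distrib)
    then show ?thesis
      unfolding zero by simp
  qed
  show ?thesis
    using variance_cluster_weighted_sum[of g w 1, OF g w bound]
    by (simp add: W zero shift cong: sum.cong)
qed

section \<open>Aggregation over clusters\<close>

lemma indep_cluster_sums:
  "indep_vars (\<lambda>_. borel) (\<lambda>g \<omega>. csize P g * zbar_cluster P g \<omega>) {..<nclust P}"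
proof -
  have "indep_vars (\<lambda>_. borel) (\<lambda>g \<omega>. \<Sum>i\<in>cluster_units P g.
      of_bool (fst ((\<lambda>i\<in>cluster_units P g. Q_unit P i \<omega>) i)) :: real) {..<nclust P}"
  proof (rule indep_vars_compose2[OF sampling[unfolded cluster_sampling_def]])
    fix g
    have [measurable]: "fst \<in> measurable (Q_space :: (bool \<times> 'p potentials) measure) (count_space UNIV)"
      unfolding Q_space_def by measurable
    show "(\<lambda>q. \<Sum>i\<in>cluster_units P g. of_bool (fst (q i)) :: real)
        \<in> borel_measurable (PiM (cluster_units P g) (\<lambda>_. Q_space :: (bool \<times> 'p potentials) measure))"
      by measurable
  qed
  then show ?thesis
    by (subst indep_vars_cong[OF refl _ refl]) (auto simp: sum_Z[symmetric] Q_unit_def)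
qed

text \<open>N zbar is the sum of the n_g zbar_g, which are independent across clusters, so its
  variance adds up to the factor of \<open>sigma_alpha\<close> squared in the 2SLS variance.\<close>

lemma c_N_sigma2_Z:
  "c_N P * sigma2_Z P = (\<Sum>g<nclust P. (csize P g)\<^sup>2 * var_zbar g) / popsize P"
proof -
  have scale: "variance (\<lambda>\<omega>. a * X \<omega>) = a\<^sup>2 * variance X" for a :: real and X
    by (simp add: power_mult_distrib flip: right_diff_distrib)
  have "zbar P = (\<lambda>\<omega>. 1 / popsize P * (\<Sum>g<nclust P. csize P g * zbar_cluster P g \<omega>))"
    by (intro ext) (simp add: zbar_def sum_all_units sum_Z del: sum_of_bool_eq cong: sum.cong_simp)
  then have "variance (zbar P) = (1 / popsize P)\<^sup>2
      * variance (\<lambda>\<omega>. \<Sum>g<nclust P. csize P g * zbar_cluster P g \<omega>)"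
    by (simp only: scale)
  also have "variance (\<lambda>\<omega>. \<Sum>g<nclust P. csize P g * zbar_cluster P g \<omega>)
      = (\<Sum>g<nclust P. variance (\<lambda>\<omega>. csize P g * zbar_cluster P g \<omega>))"
    by (rule variance_sum_indep[OF _ indep_cluster_sums])
      (simp_all add: power_mult_distrib integrable_zbar_cluster)
  also have "\<dots> = (\<Sum>g<nclust P. (csize P g)\<^sup>2 * var_zbar g)"
    by (simp only: scale of_nat_power)
  finally show ?thesis
    using sigma2_Z_pos popsize_pos by (simp add: c_N_def power2_eq_square)
qed

lemma kappa_sigma2_Z:
  "kappa P * sigma2_Z P = (\<Sum>g<nclust P. \<Sum>i\<in>cluster_units P g.
      expectation (\<lambda>\<omega>. (Z i \<omega> - zbar_cluster P g \<omega>)\<^sup>2)) / popsize P"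
proof -
  have "S_Z_in P = (\<lambda>\<omega>. (\<Sum>g<nclust P. \<Sum>i\<in>cluster_units P g.
      (Z i \<omega> - zbar_cluster P g \<omega>)\<^sup>2) / popsize P)"
    by (intro ext) (simp add: S_Z_in_def sum_all_units fst_cluster_units cong: sum.cong)
  then have "expectation (S_Z_in P) = (\<Sum>g<nclust P. \<Sum>i\<in>cluster_units P g.
      expectation (\<lambda>\<omega>. (Z i \<omega> - zbar_cluster P g \<omega>)\<^sup>2)) / popsize P"
    by (simp add: Bochner_Integration.integral_sum integrable_deviation_squares
        Bochner_Integration.integrable_sum)
  then show ?thesis
    using sigma2_Z_pos by (simp add: kappa_def)
qed

lemma kappa_nonneg: "0 \<le> kappa P"
proof -
  have "0 \<le> kappa P * sigma2_Z P"
    unfolding kappa_sigma2_Z by (intro divide_nonneg_nonneg sum_nonneg) simp_all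
  then show ?thesis
    using sigma2_Z_pos by (simp add: zero_le_mult_iff)
qed

lemma c_N_nonneg: "0 \<le> c_N P"
  using sigma2_Z_pos by (simp add: c_N_def)

section \<open>The variance formulas and their comparison\<close>

lemma V_2sls_eq:
  "V_2sls P = (sigma_eps\<^sup>2 + sigma_alpha\<^sup>2 * c_N P) / (sigma2_Z P * (pi_c P)\<^sup>2)"
proof -
  have "(\<Sum>g<nclust P. variance (\<lambda>\<omega>. \<Sum>i\<in>cluster_units P g.
        (Z i \<omega> - z_prob P) * (A_unit P i \<omega> - mu_A P)))
      = sigma_alpha\<^sup>2 * (\<Sum>g<nclust P. (csize P g)\<^sup>2 * var_zbar g)
        + sigma_eps\<^sup>2 * (popsize P * sigma2_Z P)"
    by (simp add: variance_2sls_cluster sum.distrib sum_distrib_left sum_distrib_right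
        popsize_def cong: sum.cong_simp)
  also have "(\<Sum>g<nclust P. (csize P g)\<^sup>2 * var_zbar g) = popsize P * (c_N P * sigma2_Z P)"
    using popsize_pos by (simp add: c_N_sigma2_Z)
  finally have "V_2sls P = 1 / (sigma2_Z P * pi_c P)\<^sup>2 * (1 / popsize P *
      (sigma_alpha\<^sup>2 * (popsize P * (c_N P * sigma2_Z P)) + sigma_eps\<^sup>2 * (popsize P * sigma2_Z P)))"
    by (simp only: V_2sls_def)
  \<comment> \<open>Both terms contain N sigma_Z^2; taken out, it cancels 1/N and one of the two
    factors sigma_Z^2 below.\<close>
  also have "\<dots> = 1 / (sigma2_Z P * pi_c P)\<^sup>2 * (1 / popsize P *
      (popsize P * (sigma2_Z P * (sigma_eps\<^sup>2 + sigma_alpha\<^sup>2 * c_N P))))"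
    by (simp add: algebra_simps)
  finally show ?thesis
    using sigma2_Z_pos popsize_pos by (simp add: power2_eq_square)
qed

lemma V_2sfe_eq:
  assumes "kappa P \<noteq> 0"
  shows "V_2sfe P = sigma_eps\<^sup>2 / (kappa P * sigma2_Z P * (pi_c P)\<^sup>2)"
proof -
  have "(\<Sum>g<nclust P. variance (\<lambda>\<omega>. \<Sum>i\<in>cluster_units P g.
        (Z i \<omega> - zbar_cluster P g \<omega>) * (A_unit P i \<omega> - Abar_cluster P g \<omega>)))
      = sigma_eps\<^sup>2 * (popsize P * (kappa P * sigma2_Z P))"
    using popsize_pos
    by (simp add: variance_2sfe_cluster kappa_sigma2_Z cong: sum.cong_simp flip: sum_distrib_left)
  then have "V_2sfe P = 1 / (kappa P * sigma2_Z P * pi_c P)\<^sup>2 * (1 / popsize P *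
      (sigma_eps\<^sup>2 * (popsize P * (kappa P * sigma2_Z P))))"
    by (simp only: V_2sfe_def)
  then show ?thesis
    using assms sigma2_Z_pos pi_c_pos popsize_pos by (simp add: field_simps power2_eq_square)
qed

text \<open>If the cluster means are constant, all variation of the instrument is within clusters:
  none is left for zbar, and the within part is the whole of sigma_Z^2.\<close>

lemma var_zbar_zero:
  assumes "\<forall>g<nclust P. var_zbar g = 0"
  shows "c_N P = 0" and "kappa P = 1"
proof -
  have "c_N P * sigma2_Z P = 0"
    using assms by (simp add: c_N_sigma2_Z)
  then show "c_N P = 0"
    using sigma2_Z_pos by simp
  have "kappa P * sigma2_Z P = (\<Sum>g<nclust P. csize P g * sigma2_Z P) / popsize P"
    using assms by (simp add: kappa_sigma2_Z expectation_within_squares cong: sum.cong_simp)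
  also have "\<dots> = sigma2_Z P"
  proof -
    have "(\<Sum>g<nclust P. csize P g * sigma2_Z P) = popsize P * sigma2_Z P"
      by (simp add: popsize_def sum_distrib_right)
    then show ?thesis
      using popsize_pos by simp
  qed
  finally show "kappa P = 1"
    using sigma2_Z_pos by simp
qed

lemma sigma_eps_pos: "0 < sigma_eps\<^sup>2"
  using model by (simp add: outcome_model_def)

text \<open>The case c_N = 0 is excluded from the equivalence because 1 / 0 = 0 in HOL. There all
  cluster means have variance 0, so the two variances agree, whereas the right-hand side would read
  0 < \<open>sigma_alpha\<^sup>2 / sigma_eps\<^sup>2\<close>, which may well hold.\<close>

lemma variance_comparison:
  assumes kappa: "0 < kappa P"
  shows "V_2sls P / V_2sfe P = kappa P * (1 + sigma_alpha\<^sup>2 / sigma_eps\<^sup>2 * c_N P)"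
    and "c_N P \<noteq> 0 \<Longrightarrow> V_2sls P > V_2sfe P \<longleftrightarrow>
      sigma_alpha\<^sup>2 / sigma_eps\<^sup>2 > (1 - kappa P) / kappa P * (1 / c_N P)"
    and "\<forall>g<nclust P. var_zbar g = 0 \<Longrightarrow> V_2sls P = V_2sfe P"
proof -
  note V = V_2sls_eq V_2sfe_eq[OF less_imp_neq[OF kappa, symmetric]]
  show ratio: "V_2sls P / V_2sfe P = kappa P * (1 + sigma_alpha\<^sup>2 / sigma_eps\<^sup>2 * c_N P)"
    unfolding V using kappa sigma2_Z_pos pi_c_pos sigma_eps_pos
    by (simp add: field_simps)
  have "0 < V_2sfe P"
    unfolding V using kappa sigma2_Z_pos pi_c_pos sigma_eps_pos by simp
  then have "V_2sls P > V_2sfe P \<longleftrightarrow> 1 < V_2sls P / V_2sfe P"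
    by simp
  also have "\<dots> \<longleftrightarrow> (1 - kappa P) / kappa P < sigma_alpha\<^sup>2 / sigma_eps\<^sup>2 * c_N P"
    unfolding ratio using kappa by (simp add: divide_less_eq algebra_simps)
  finally have iff: "V_2sls P > V_2sfe P \<longleftrightarrow>
      (1 - kappa P) / kappa P < sigma_alpha\<^sup>2 / sigma_eps\<^sup>2 * c_N P" .
  show "V_2sls P > V_2sfe P \<longleftrightarrow>
      sigma_alpha\<^sup>2 / sigma_eps\<^sup>2 > (1 - kappa P) / kappa P * (1 / c_N P)" if "c_N P \<noteq> 0"
  proof -
    have "0 < c_N P"
      using that c_N_nonneg by simp
    from pos_divide_less_eq[OF this, of "(1 - kappa P) / kappa P" "sigma_alpha\<^sup>2 / sigma_eps\<^sup>2"]
    show ?thesis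
      unfolding iff by (simp only: times_divide_eq_right mult_1_right)
  qed
  show "V_2sls P = V_2sfe P" if "\<forall>g<nclust P. var_zbar g = 0"
    unfolding V using var_zbar_zero[OF that] by simp
qed

end

theorem theorem1:
  fixes P :: "nat \<Rightarrow> ('w, 'p::finite) population"
    and mu_alpha sigma_alpha sigma_eps :: real
  assumes population: "\<And>k. clustered_population (P k)"
    and size_infinity: "filterlim (\<lambda>k. popsize (P k)) at_top sequentially"
    and sampling: "\<And>k. cluster_sampling (P k)"
    and iv: "\<And>k. iv_assumptions (P k)"
    and homogeneous: "\<And>k. homogeneous_clusters (P k)"
    and sizes: "cluster_size_condition P"
    and model: "\<And>k. outcome_model (P k) mu_alpha sigma_alpha sigma_eps"
    and moments: "\<And>k i. i \<in> all_units (P k) \<Longrightarrow> integrable (pmeas (P k)) (\<lambda>\<omega>. (y_obs (P k) i \<omega>) ^ 4)"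
    and rank: "0 < (INF k. kappa (P k))"
  shows "\<forall>k.
      V_2sls (P k) = (sigma_eps\<^sup>2 + sigma_alpha\<^sup>2 * c_N (P k)) / (sigma2_Z (P k) * (pi_c (P k))\<^sup>2) \<and>
      V_2sfe (P k) = sigma_eps\<^sup>2 / (kappa (P k) * sigma2_Z (P k) * (pi_c (P k))\<^sup>2) \<and>
      V_2sls (P k) / V_2sfe (P k) = kappa (P k) * (1 + sigma_alpha\<^sup>2 / sigma_eps\<^sup>2 * c_N (P k)) \<and>
      (c_N (P k) \<noteq> 0 \<longrightarrow>
        (V_2sls (P k) > V_2sfe (P k) \<longleftrightarrow>
         sigma_alpha\<^sup>2 / sigma_eps\<^sup>2 > (1 - kappa (P k)) / kappa (P k) * (1 / c_N (P k)))) \<and>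
      ((\<forall>g<nclust (P k). var (P k) (zbar_cluster (P k) g) = 0) \<longrightarrow> V_2sls (P k) = V_2sfe (P k))"
proof
  fix k
  have iv_model: "iv_outcome_model (P k) mu_alpha sigma_alpha sigma_eps" for k
    using population sampling iv homogeneous model by unfold_locales
  interpret iv_outcome_model "P k" mu_alpha sigma_alpha sigma_eps
    by (rule iv_model)
  \<comment> \<open>A real infimum is a lower bound only for a family that is bounded below, so
    nonnegativity of \<open>kappa\<close> is required in all populations at once; hence
    \<open>iv_model\<close> is stated for every k.\<close>
  have "bdd_below (range (\<lambda>k. kappa (P k)))"
    using iv_outcome_model.kappa_nonneg[OF iv_model] by (intro bdd_belowI[of _ 0]) auto
  then have "(INF k. kappa (P k)) \<le> kappa (P k)"
    by (rule cINF_lower) simp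
  with rank have kappa: "0 < kappa (P k)"
    by simp
  show "V_2sls (P k) = (sigma_eps\<^sup>2 + sigma_alpha\<^sup>2 * c_N (P k)) / (sigma2_Z (P k) * (pi_c (P k))\<^sup>2) \<and>
      V_2sfe (P k) = sigma_eps\<^sup>2 / (kappa (P k) * sigma2_Z (P k) * (pi_c (P k))\<^sup>2) \<and>
      V_2sls (P k) / V_2sfe (P k) = kappa (P k) * (1 + sigma_alpha\<^sup>2 / sigma_eps\<^sup>2 * c_N (P k)) \<and>
      (c_N (P k) \<noteq> 0 \<longrightarrow>
        (V_2sls (P k) > V_2sfe (P k) \<longleftrightarrow>
         sigma_alpha\<^sup>2 / sigma_eps\<^sup>2 > (1 - kappa (P k)) / kappa (P k) * (1 / c_N (P k)))) \<and>
      ((\<forall>g<nclust (P k). var (P k) (zbar_cluster (P k) g) = 0) \<longrightarrow> V_2sls (P k) = V_2sfe (P k))"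
    using V_2sls_eq V_2sfe_eq variance_comparison[OF kappa] kappa by simp
qed

end
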